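(* Let $n\ge1$ and $\mathfrak{R}^a=S^2(\rho(sp(n)\oplus u(1)))\cap b^{-1}(\mathbb{R}\,\sigma_{T_0+\overline{T}_0})$. As a real representation of $\rho(Sp(n)U(1))$, $\mathfrak{R}^a\cong\mathbb{R}\oplus r(S^4E)$. If $R^a\in\mathfrak{R}^a$ and the corresponding torsion is $T^a=\lambda T_0+\bar\lambda\overline{T}_0$, $\lambda\in\mathbb{C}$ (i.e. $bR^a=\sigma_{T^a}$), then with respect to this isomorphism $$R^a=\frac{|T^a|^2}{48n}R^a_0+R_{hyper},$$ where $R_{hyper}$ has the properties of an algebraic hyper-Kähler curvature tensor on $\mathcal{H}$ and $$\begin{aligned}R^a_0(X,Y,Z,W)=&\sum_{L\in\{\mathbf 1,I,J,K\}}\big(g_{|\mathcal{H}}(LY,Z)g_{|\mathcal{H}}(LX,W)-g_{|\mathcal{H}}(LX,Z)g_{|\mathcal{H}}(LY,W)\big)\\&-2\big(g_{|\mathcal{H}}(JX,Y)g_{|\mathcal{H}}(JZ,W)+2g_{|\mathcal{H}}(JX,Y)g_{|\mathcal{V}}(JZ,W)\\&\quad+2g_{|\mathcal{V}}(JX,Y)g_{|\mathcal{H}}(JZ,W)+4g_{|\mathcal{V}}(JX,Y)g_{|\mathcal{V}}(JZ,W)\big).\end{aligned}$$ The Ricci tensor $Ric^a$ and the scalar curvature $s^a$ of $R^a$ are $$Ric^a=\frac{|T^a|^2}{12n}\big((n+1)g_{|\mathcal{H}}+2g_{|\mathcal{V}}\big),\qquad s^a=\frac{(n^2+n+1)|T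^a|^2}{3n}.$$
   Context: $Sp(n)U(1)=\{ab: a\in Sp(n),b\in U(1)\}\subset U(2n)$ ($U(1)$ acting by scalars), and $\rho:Sp(n)U(1)\to U(2n)\times U(1)\subset U(2n+1)\subset SO(4n+2)$ is $\rho(ab)=\begin{pmatrix}ab&0\\0&b^2\end{pmatrix}$. $T=\mathcal{H}\oplus\mathcal{V}\cong\mathbb{C}^{2n}\oplus\mathbb{C}$ is the standard real $(4n+2)$-dimensional representation with inner product $g$ and complex structure $J$; $e_1,\dots,e_{2n}$ and $e_{2n+1}$ are the standard unitary bases of $\mathcal{H}^{1,0}$ and $\mathcal{V}^{1,0}$ (so $g(e_i,\bar e_j)=\delta_{ij}$ for the complex bilinear extension of $g$), with dual basis $e^1,\dots,e^{2n+1}$. Put $\omega_0=\sum_{k=1}^ne^{2k-1}\wedge e^{2k}$ ($Sp(n)$ is the stabilizer of $\omega_0$ in $U(2n)$) and $T_0=\omega_0\wedge\bar e^{2n+1}$. $K,I\in End(T)$ are the real endomorphisms defined by $g((K+iI)X,Y)=2\omega_0(X,Y)$, $X,Y\in T$; they vanish on $\mathcal{V}$, preserve $\mathcal{H}$, and on $\mathcal{H}$ the maps $I,J,K$ are orthogonal and satisfy the quaternionic identities. $g_{|\mathcal{H}}$, $g_{|\mathcal{V}}$ are the restrictions of $g$ extended by zero. For a real 3-form $\Theta$ on $T$, let $g(\Theta(X,Y),Z)=\Theta(X,Y,Z)$ and $\sigma_\Theta(X,Y,Z,W)=\mathfrak{S}_{X,Y,Z}\,g(\Theta(X,Y),\Theta(Z,W))$,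 with $\mathfrak{S}$ the cyclic sum; $(bR)(X,Y,Z,W)=\mathfrak{S}_{X,Y,Z}R(X,Y,Z,W)$ for $R\in(T^* )^{\otimes4}$. $\rho(sp(n)\oplus u(1))\subset so(T)\cong\Lambda^2T^*$ is the Lie algebra of $\rho(Sp(n)U(1))$, and its symmetric square is a subspace of $(T^* )^{\otimes4}$. $|T^a|^2$ is the tensorial norm (sum of squares of all components in a $g$-orthonormal basis), so $|T^a|^2=12n|\lambda|^2$. $E$ is the standard $2n$-dimensional complex representation of $Sp(n)$; $r(S^4E)$ is the real representation underlying $S^4E$, i.e. the real form with $r(S^4E)\otimes\mathbb{C}\cong S^4E$ ($U(1)$ acts trivially). An algebraic hyper-Kähler curvature tensor on $\mathcal{H}$ is an algebraic curvature tensor on $\mathcal{H}$ (all symmetries of a Riemannian curvature tensor, including the first Bianchi identity; extended by zero to $T$) such that each $R(X,Y)$ commutes with $I,J,K$, i.e. lies in $sp(n)$. Conventions: $R(X,Y,Z,W)=g(R(X,Y)Z,W)$, $Ric(Y,Z)=\sum_iR(\varepsilon_i,Y,Z,\varepsilon_i)$ for a $g$-orthonormal basis $\{\varepsilon_i\}$, and the scalar curvature is the $g$-trace of $Ric$. *)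

theory Defs
  imports "HOL-Analysis.Analysis"
begin

section \<open>The representation T and its forms\<close>

text \<open>
  Here n is the cardinality of the index type 'n.  The index Inl k plays the role of 2k-1 and
  Inr k the role of 2k.  The metric g on T is the library's real inner product
  (the real part of the standard Hermitian product), so multiplication by the imaginary unit
  is the complex structure.
\<close>

type_synonym 'n E = "complex ^ ('n + 'n)"
type_synonym 'n T = "(complex ^ ('n + 'n)) \<times> complex"
type_synonym 'n tensor3 = "'n T \<Rightarrow> 'n T \<Rightarrow> 'n T \<Rightarrow> real"
type_synonym 'n tensor4 = "'n T \<Rightarrow> 'n T \<Rightarrow> 'n T \<Rightarrow> 'n T \<Rightarrow> real"

definition g_hor :: "'n::finite T \<Rightarrow> 'n T \<Rightarrow> real" where
  "g_hor X Y = fst X \<bullet> fst Y"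

definition g_ver :: "'n::finite T \<Rightarrow> 'n T \<Rightarrow> real" where
  "g_ver X Y = snd X \<bullet> snd Y"

text \<open>The vector dual to a linear form with respect to g.\<close>

definition riesz :: "('a::euclidean_space \<Rightarrow> real) \<Rightarrow> 'a" where
  "riesz f = (THE v. \<forall>w. v \<bullet> w = f w)"

lemma riesz_inner:
  assumes "linear f"
  shows "riesz f \<bullet> w = f w"
proof -
  define v where "v = (\<Sum>b\<in>Basis. f b *\<^sub>R b)"
  have v: "v \<bullet> w = f w" for w
  proof -
    have "f w = f (\<Sum>b\<in>Basis. (w \<bullet> b) *\<^sub>R b)"
      by (simp add: euclidean_representation)
    also have "\<dots> = (\<Sum>b\<in>Basis. (w \<bullet> b) * f b)"
      using assms by (simp add: linear_sum linear_scale)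
    also have "\<dots> = v \<bullet> w"
      by (simp add: v_def inner_sum_left inner_commute[of w] mult.commute)
    finally show ?thesis by simp
  qed
  have "riesz f = v"
    unfolding riesz_def
  proof (rule the_equality)
    show "\<forall>w. v \<bullet> w = f w" using v by simp
    show "u = v" if "\<forall>w. u \<bullet> w = f w" for u
      using that v by (metis vector_eq_rdot)
  qed
  with v show ?thesis by simp
qed

text \<open>
  Complex-valued forms on T stand for complex multilinear forms on the complexification of T.
  If x is a real unit vector of the standard basis, the corresponding unitary vector of type (1,0)
  is e = (x - iJx) / sqrt 2, since g(e, cnj e) = 1.  Hence the dual forms e^1, ..., e^(2n) (dual_hor) and
  e^(2n+1) (dual_ver) are the standard coordinates divided by sqrt 2.
\<close>

definition dual_hor :: "'n::finite + 'n \<Rightarrow> 'n T \<Rightarrow> complex" where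
  "dual_hor i X = (fst X $ i) / complex_of_real (sqrt 2)"

definition dual_ver :: "'n::finite T \<Rightarrow> complex" where
  "dual_ver X = snd X / complex_of_real (sqrt 2)"

lemma inner_eq_dual_basis:
  fixes X Y :: "'n::finite T"
  shows "complex_of_real (X \<bullet> Y) =
    (\<Sum>i\<in>UNIV. dual_hor i X * cnj (dual_hor i Y) + cnj (dual_hor i X) * dual_hor i Y)
    + (dual_ver X * cnj (dual_ver Y) + cnj (dual_ver X) * dual_ver Y)"
proof -
  have *: "(a / complex_of_real (sqrt 2)) * cnj (b / complex_of_real (sqrt 2))
      + cnj (a / complex_of_real (sqrt 2)) * (b / complex_of_real (sqrt 2)) = complex_of_real (a \<bullet> b)" for a b
    by (auto simp: complex_eq_iff inner_complex_def field_simps)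
  show ?thesis
    unfolding dual_hor_def dual_ver_def * by (simp add: inner_prod_def inner_vec_def)
qed

text \<open>Wedge products without factorials in the denominator.\<close>

definition wedge11 :: "('a \<Rightarrow> complex) \<Rightarrow> ('a \<Rightarrow> complex) \<Rightarrow> 'a \<Rightarrow> 'a \<Rightarrow> complex" where
  "wedge11 \<alpha> \<beta> X Y = \<alpha> X * \<beta> Y - \<alpha> Y * \<beta> X"

definition wedge21 :: "('a \<Rightarrow> 'a \<Rightarrow> complex) \<Rightarrow> ('a \<Rightarrow> complex) \<Rightarrow> 'a \<Rightarrow> 'a \<Rightarrow> 'a \<Rightarrow> complex" where
  "wedge21 \<omega> \<beta> X Y Z = \<omega> X Y * \<beta> Z + \<omega> Y Z * \<beta> X + \<omega> Z X * \<beta> Y"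

definition omega0 :: "'n::finite T \<Rightarrow> 'n T \<Rightarrow> complex" where
  "omega0 X Y = (\<Sum>k\<in>UNIV. wedge11 (dual_hor (Inl k)) (dual_hor (Inr k)) X Y)"

definition T0 :: "'n::finite T \<Rightarrow> 'n T \<Rightarrow> 'n T \<Rightarrow> complex" where
  "T0 = wedge21 omega0 (\<lambda>X. cnj (dual_ver X))"

text \<open>The real 3-form z T0 + cnj (z T0).\<close>

definition torsion :: "complex \<Rightarrow> 'n::finite tensor3" where
  "torsion z X Y Z = Re (z * T0 X Y Z + cnj z * cnj (T0 X Y Z))"

definition norm3_sq :: "'n::finite tensor3 \<Rightarrow> real" where
  "norm3_sq \<Theta> = (\<Sum>u\<in>Basis. \<Sum>v\<in>Basis. \<Sum>w\<in>Basis. (\<Theta> u v w)\<^sup>2)"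

definition endJ :: "'n::finite T \<Rightarrow> 'n T" where
  "endJ X = (\<i> *s fst X, \<i> * snd X)"

definition endK :: "'n::finite T \<Rightarrow> 'n T" where
  "endK X = riesz (\<lambda>Y. Re (2 * omega0 X Y))"

definition endI :: "'n::finite T \<Rightarrow> 'n T" where
  "endI X = riesz (\<lambda>Y. Im (2 * omega0 X Y))"

lemma endK_endI:
  "complex_of_real (endK X \<bullet> Y) + \<i> * complex_of_real (endI X \<bullet> Y) = 2 * omega0 X Y"
proof -
  have "linear (\<lambda>Y. Re (2 * omega0 X Y))" "linear (\<lambda>Y. Im (2 * omega0 X Y))"
    by (intro linearI;
        simp add: omega0_def wedge11_def dual_hor_def algebra_simps sum.distrib sum_subtractf
          sum_distrib_left add_divide_distrib diff_divide_distrib)+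
  then show ?thesis
    unfolding endK_def endI_def by (simp add: riesz_inner complex_eq_iff)
qed


section \<open>Curvature tensors\<close>

definition sigma_form :: "'n::finite tensor3 \<Rightarrow> 'n tensor4" where
  "sigma_form \<Theta> X Y Z W =
     riesz (\<Theta> X Y) \<bullet> riesz (\<Theta> Z W) + riesz (\<Theta> Y Z) \<bullet> riesz (\<Theta> X W)
     + riesz (\<Theta> Z X) \<bullet> riesz (\<Theta> Y W)"

definition bianchi :: "'n::finite tensor4 \<Rightarrow> 'n tensor4" where
  "bianchi R X Y Z W = R X Y Z W + R Y Z X W + R Z X Y W"

definition curv_op :: "'n::finite tensor4 \<Rightarrow> 'n T \<Rightarrow> 'n T \<Rightarrow> 'n T \<Rightarrow> 'n T" where
  "curv_op R X Y Z = riesz (R X Y Z)"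

definition Ric :: "'n::finite tensor4 \<Rightarrow> 'n T \<Rightarrow> 'n T \<Rightarrow> real" where
  "Ric R Y Z = (\<Sum>u\<in>Basis. R u Y Z u)"

definition scal :: "'n::finite tensor4 \<Rightarrow> real" where
  "scal R = (\<Sum>u\<in>Basis. Ric R u u)"

definition algebraic_curvature_tensor :: "'n::finite tensor4 \<Rightarrow> bool" where
  "algebraic_curvature_tensor R \<longleftrightarrow>
     (\<forall>Y Z W. linear (\<lambda>X. R X Y Z W)) \<and> (\<forall>X Z W. linear (\<lambda>Y. R X Y Z W)) \<and>
     (\<forall>X Y W. linear (\<lambda>Z. R X Y Z W)) \<and> (\<forall>X Y Z. linear (\<lambda>W. R X Y Z W)) \<and>
     (\<forall>X Y Z W. R X Y Z W = - R Y X Z W) \<and> (\<forall>X Y Z W. R X Y Z W = - R X Y W Z) \<and>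
     (\<forall>X Y Z W. R X Y Z W = R Z W X Y) \<and> (\<forall>X Y Z W. bianchi R X Y Z W = 0)"

text \<open>A hyper-Kaehler curvature tensor on the horizontal space, extended by zero to T.\<close>

definition hyperkaehler_tensor :: "'n::finite tensor4 \<Rightarrow> bool" where
  "hyperkaehler_tensor R \<longleftrightarrow>
     algebraic_curvature_tensor R \<and>
     (\<forall>X Y Z W. fst X = 0 \<or> fst Y = 0 \<or> fst Z = 0 \<or> fst W = 0 \<longrightarrow> R X Y Z W = 0) \<and>
     (\<forall>X Y. \<forall>L\<in>{endI, endJ, endK}. curv_op R X Y \<circ> L = L \<circ> curv_op R X Y)"

text \<open>The first sum runs over a list, so that the four maps are counted separately.\<close>

definition R0 :: "'n::finite tensor4" where
  "R0 X Y Z W =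
     (\<Sum>L\<leftarrow>[id, endI, endJ, endK].
        g_hor (L Y) Z * g_hor (L X) W - g_hor (L X) Z * g_hor (L Y) W)
     - 2 * (g_hor (endJ X) Y * g_hor (endJ Z) W + 2 * (g_hor (endJ X) Y * g_ver (endJ Z) W)
          + 2 * (g_ver (endJ X) Y * g_hor (endJ Z) W) + 4 * (g_ver (endJ X) Y * g_ver (endJ Z) W))"


section \<open>The group, its Lie algebra and the space of curvature tensors\<close>

definition unitary_matrices :: "(complex ^ 'm ^ 'm::finite) set" where
  "unitary_matrices = {A. A ** transpose (map_matrix cnj A) = mat 1}"

definition Sp :: "(complex ^ ('n + 'n) ^ ('n + 'n::finite)) set" where
  "Sp = {A \<in> unitary_matrices. \<forall>u v. omega0 (A *v u, 0) (A *v v, 0) = omega0 (u, 0) (v, 0)}"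

definition U1 :: "complex set" where
  "U1 = {b. cmod b = 1}"

text \<open>
  The image of ab under rho, for a in Sp(n) and b in U(1).  It depends only on the product ab:
  the pair (a, b) is determined by ab up to a common sign.
\<close>

definition rho :: "complex ^ ('n + 'n) ^ ('n + 'n) \<Rightarrow> complex \<Rightarrow> 'n::finite T \<Rightarrow> 'n T" where
  "rho a b X = (b *s (a *v fst X), b\<^sup>2 * snd X)"

definition rho_group :: "('n::finite T \<Rightarrow> 'n T) set" where
  "rho_group = {rho a b | a b. a \<in> Sp \<and> b \<in> U1}"

text \<open>
  The Lie algebra of a closed group of linear maps as its tangent space at the identity: the
  velocities of curves through the identity.  (In finite dimension, pointwise differentiability
  of a curve of linear maps is differentiability.)
\<close>

definition lie_algebra :: "('a::euclidean_space \<Rightarrow> 'a) set \<Rightarrow> ('a \<Rightarrow> 'a) set" where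
  "lie_algebra G = {A. \<exists>\<gamma> :: real \<Rightarrow> 'a \<Rightarrow> 'a. (\<forall>t. \<gamma> t \<in> G) \<and> \<gamma> 0 = id \<and>
     (\<forall>X. ((\<lambda>t. \<gamma> t X) has_vector_derivative A X) (at 0))}"

text \<open>The Lie algebra as a space of 2-forms, under the identification of so(T) with 2-forms.\<close>

definition rho_forms :: "('n::finite T \<Rightarrow> 'n T \<Rightarrow> real) set" where
  "rho_forms = {(\<lambda>X Y. A X \<bullet> Y) | A. A \<in> lie_algebra rho_group}"

text \<open>Real coefficients are not needed in the sums below since they can be absorbed in h.\<close>

definition sym_square :: "('n::finite T \<Rightarrow> 'n T \<Rightarrow> real) set \<Rightarrow> 'n tensor4 set" where
  "sym_square h = {R. \<exists>(N::nat) \<alpha> \<beta>. (\<forall>i<N. \<alpha> i \<in> h \<and> \<beta> i \<in> h) \<and>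
     R = (\<lambda>X Y Z W. \<Sum>i<N. \<alpha> i X Y * \<beta> i Z W + \<beta> i X Y * \<alpha> i Z W)}"

definition curv_space :: "'n::finite tensor4 set" where
  "curv_space = {R \<in> sym_square rho_forms.
     \<exists>c::real. bianchi R = (\<lambda>X Y Z W. c * sigma_form (torsion 1) X Y Z W)}"

definition act_tensor4 :: "('n::finite T \<Rightarrow> 'n T) \<Rightarrow> 'n tensor4 \<Rightarrow> 'n tensor4" where
  "act_tensor4 h R X Y Z W = R (inv h X) (inv h Y) (inv h Z) (inv h W)"


section \<open>The fourth symmetric power of E and its real form\<close>

type_synonym 'n E4 = "complex ^ ('n + 'n) ^ ('n + 'n) ^ ('n + 'n) ^ ('n + 'n)"

definition S4E :: "'n::finite E4 set" where
  "S4E = {s. \<forall>i j k l. s $ i $ j $ k $ l = s $ j $ i $ k $ l \<and>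
     s $ i $ j $ k $ l = s $ i $ k $ j $ l \<and> s $ i $ j $ k $ l = s $ i $ j $ l $ k}"

definition act_E4 :: "complex ^ ('n + 'n) ^ ('n + 'n) \<Rightarrow> 'n::finite E4 \<Rightarrow> 'n E4" where
  "act_E4 a s = (\<chi> i j k l. \<Sum>p\<in>UNIV. \<Sum>q\<in>UNIV. \<Sum>r\<in>UNIV. \<Sum>t\<in>UNIV.
     a $ i $ p * a $ j $ q * a $ k $ r * a $ l $ t * s $ p $ q $ r $ t)"

definition i_times_E4 :: "'n::finite E4 \<Rightarrow> 'n E4" where
  "i_times_E4 s = (\<chi> i j k l. \<i> * s $ i $ j $ k $ l)"

text \<open>
  V is a real subrepresentation of S4E and the complexification of V is identified with S4E by
  sending u + iv to u + i v.
\<close>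

definition real_form_S4E :: "'n::finite E4 set \<Rightarrow> bool" where
  "real_form_S4E V \<longleftrightarrow>
     subspace V \<and> V \<subseteq> S4E \<and> (\<forall>a\<in>Sp. act_E4 a ` V \<subseteq> V) \<and>
     bij_betw (\<lambda>(u, v). u + i_times_E4 v) (V \<times> V) S4E"

text \<open>
  F is an isomorphism of real representations of the group from the direct sum of the trivial
  representation and V onto curv_space, where rho a b acts on V through a.
\<close>

definition curv_space_iso :: "'n::finite E4 set \<Rightarrow> (real \<times> 'n E4 \<Rightarrow> 'n tensor4) \<Rightarrow> bool" where
  "curv_space_iso V F \<longleftrightarrow>
     bij_betw F (UNIV \<times> V) curv_space \<and>
     (\<forall>p \<in> UNIV \<times> V. \<forall>q \<in> UNIV \<times> V. \<forall>c::real.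
        F (p + q) = (\<lambda>X Y Z W. F p X Y Z W + F q X Y Z W) \<and>
        F (c *\<^sub>R p) = (\<lambda>X Y Z W. c * F p X Y Z W)) \<and>
     (\<forall>a\<in>Sp. \<forall>b\<in>U1. \<forall>x. \<forall>v\<in>V. F (x, act_E4 a v) = act_tensor4 (rho a b) (F (x, v)))"

end

(*
  On the horizontal space H the forms in sp(n) are the skew bilinear forms a that are invariant under
  i and under the antilinear map K, here called qj.  So rho(sp(n) + u(1)) consists of the forms
  a + s * beta with a in sp(n) and beta the generator of u(1); a curve with prescribed velocity in
  sp(n) is given by the Cayley transform, which replaces the exponential.

  The explicit tensor R0 satisfies b R0 = 4 sigma for the torsion with parameter 1, so modulo R0 only
  ker b matters.  An element of S^2(sp(n) + u(1)) is S + beta d + d beta + k beta^2, and on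
  two horizontal and two vertical vectors the Bianchi identity reads d + k g(J.,.) = 0; since d is
  K-invariant and g(J.,.) is K-anti-invariant, d = 0 and k = 0.  Hence ker b consists of
  hyper-Kaehler tensors, which are Ricci flat.  Finally a real quartic form N on E corresponds to the
  hyper-Kaehler tensor Re (N(Kx,y,Kz,w) - N(Ky,x,Kz,w)) / 2: the symmetry of N is the Bianchi identity.
*)
theory Submission
  imports Defs
begin

section \<open>The quaternionic structure of the horizontal space\<close>

text \<open>An element of the group determines a and b only up to a common sign, so a curve in the
  group is never lifted to curves of a and b. Instead, equations in the group element alone are
  differentiated (\<open>rho_groupD\<close>); the decisive one compares h with \<open>qj\<close> and
  reads the factor b^2 off from V. The constant in the theorem comes from b R0 = 4 sigma. Since
  sigma depends on lambda only through |lambda|^2, the coefficient of R0 is |lambda|^2 / 4, and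
  |T^a|^2 = 12 n |lambda|^2 turns this into |T^a|^2 / (48 n). For quartic forms the obstacle is that
  r is only real multilinear. Its complex extension \<open>sesq\<close> is linear in x, z and
  antilinear in y, w; applying K to x and z makes all four arguments antilinear, and only then can
  they be exchanged. Accordingly, tensors over E are treated as antilinear forms. U(1) acts
  trivially on this part because K conjugates scalars, so that factors b and \<open>cnj b\<close>
  meet in pairs.\<close>

lemma sum_UNIV_Plus:
  fixes f :: "'a::finite + 'b::finite \<Rightarrow> 'c::comm_monoid_add"
  shows "(\<Sum>p\<in>UNIV. f p) = (\<Sum>k\<in>UNIV. f (Inl k)) + (\<Sum>k\<in>UNIV. f (Inr k))"
  unfolding UNIV_Plus_UNIV[symmetric] by (subst sum.Plus) auto

definition qj :: "'n::finite E \<Rightarrow> 'n E" where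
  "qj x = (\<chi> p. case p of Inl k \<Rightarrow> - cnj (x $ Inr k) | Inr k \<Rightarrow> cnj (x $ Inl k))"

lemma qj_nth [simp]: "qj x $ Inl k = - cnj (x $ Inr k)" "qj x $ Inr k = cnj (x $ Inl k)"
  by (simp_all add: qj_def)

lemma vec_eq_Plus_iff: "x = y \<longleftrightarrow> (\<forall>k. x $ Inl k = y $ Inl k) \<and> (\<forall>k. x $ Inr k = y $ Inr k)"
  by (metis (mono_tags) vec_eq_iff sumE)

lemma qj_linear [simp]:
  "qj (x + y) = qj x + qj y" "qj (x - y) = qj x - qj y" "qj (- x) = - qj x"
  "qj (r *\<^sub>R x) = r *\<^sub>R qj x" "qj 0 = 0" "qj (c *s x) = cnj c *s qj x" "qj (qj x) = - x"
  by (simp_all add: vec_eq_Plus_iff)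

lemma linear_qj: "linear qj"
  by (rule linearI) simp_all

lemma inner_qj_qj: "qj x \<bullet> qj y = x \<bullet> y"
  by (simp add: inner_vec_def sum_UNIV_Plus inner_complex_def add.commute)

lemma inner_qj_left: "qj x \<bullet> y = - (x \<bullet> qj y)"
  using inner_qj_qj[of x "qj y"] by simp

lemma vec_i_i [simp]: "\<i> *s (\<i> *s x) = - (x :: complex ^ 'm)"
  by (simp add: vec_eq_iff)

lemma vec_i_linear:
  "\<i> *s (x + y) = \<i> *s x + \<i> *s (y :: complex ^ 'm)" "\<i> *s (x - y) = \<i> *s x - \<i> *s y"
  "\<i> *s (- x) = - (\<i> *s x)" "\<i> *s (r *\<^sub>R x) = r *\<^sub>R (\<i> *s x)" "\<i> *s (0 :: complex ^ 'm) = 0"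
  "(- c) *s x = - (c *s x)"
  by (simp_all add: vec_eq_iff algebra_simps)

lemma vec_complex_scaleR: "complex_of_real r *s x = r *\<^sub>R (x :: complex ^ 'm)"
  by (simp add: vec_eq_iff complex_eq_iff)

lemma vec_complex_split: "c *s x = Re c *\<^sub>R x + Im c *\<^sub>R (\<i> *s (x :: complex ^ 'm))"
  by (simp add: vec_eq_iff complex_eq_iff)

lemma linear_vec_i: "linear (\<lambda>x :: complex ^ 'm. \<i> *s x)"
  by (rule linearI) (simp_all add: vec_i_linear)

lemma inner_i_i: "(\<i> *s x) \<bullet> (\<i> *s y) = x \<bullet> (y :: complex ^ 'm)"
  by (simp add: inner_vec_def inner_complex_def add.commute)

lemma inner_i_left: "(\<i> *s x) \<bullet> y = - (x \<bullet> (\<i> *s (y :: complex ^ 'm)))"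
  using inner_i_i[of x "\<i> *s y"] by simp

text \<open>This is Re(uv) = Re u Re v - Im u Im v for u = \<open>cnj c * d\<close> and v the
  Hermitian product of x and y. The scalars are conjugated because vertical coordinates enter the
  torsion conjugated.\<close>

lemma inner_scale_scale:
  fixes x y :: "complex ^ 'm"
  shows "(cnj c *s x) \<bullet> (cnj d *s y) = (c \<bullet> d) * (x \<bullet> y) + ((\<i> * c) \<bullet> d) * ((\<i> *s x) \<bullet> y)"
  unfolding vec_complex_split[of "cnj c"] vec_complex_split[of "cnj d"]
  by (simp add: inner_add_left inner_add_right inner_i_i inner_i_left inner_complex_def algebra_simps)

text \<open>The two factors 1/sqrt 2 of the dual basis give the 1/2. Hence on the horizontal space K
  is \<open>qj\<close> and I is i \<open>qj\<close>.\<close>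

lemma omega0_eq:
  "omega0 X Y = Complex (qj (fst X) \<bullet> fst Y) ((\<i> *s qj (fst X)) \<bullet> fst Y) / 2"
proof -
  have w: "2 * wedge11 (dual_hor (Inl k)) (dual_hor (Inr k)) X Y =
      fst X $ Inl k * fst Y $ Inr k - fst Y $ Inl k * fst X $ Inr k" for k
    by (simp add: wedge11_def dual_hor_def of_real_mult[symmetric] diff_divide_distrib del: of_real_mult)
  have "2 * omega0 X Y = (\<Sum>k\<in>UNIV. fst X $ Inl k * fst Y $ Inr k - fst Y $ Inl k * fst X $ Inr k)"
    unfolding omega0_def sum_distrib_left w ..
  also have "\<dots> = Complex (qj (fst X) \<bullet> fst Y) ((\<i> *s qj (fst X)) \<bullet> fst Y)"
    by (simp add: complex_eq_iff inner_vec_def inner_complex_def sum_UNIV_Plus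
        sum.distrib sum_subtractf sum_negf algebra_simps)
  finally show ?thesis by (simp add: field_simps)
qed

lemma riesz_eqI: "(\<And>w. v \<bullet> w = f w) \<Longrightarrow> riesz f = v"
  unfolding riesz_def by (rule the_equality) (auto, metis vector_eq_rdot)

lemma endK_eq: "endK X = (qj (fst X), 0)"
  unfolding endK_def by (rule riesz_eqI) (simp add: omega0_eq inner_prod_def)

lemma endI_eq: "endI X = (\<i> *s qj (fst X), 0)"
  unfolding endI_def by (rule riesz_eqI) (simp add: omega0_eq inner_prod_def)

definition sp_form :: "('n::finite E \<Rightarrow> 'n E \<Rightarrow> real) \<Rightarrow> bool" where
  "sp_form a \<longleftrightarrow> bilinear a \<and> (\<forall>x y. a y x = - a x y) \<and>
     (\<forall>x y. a (\<i> *s x) (\<i> *s y) = a x y) \<and> (\<forall>x y. a (qj x) (qj y) = a x y)"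

text \<open>The generator of u(1) as a 2-form: the velocity of diag(b, b^2) at b = 1 is i on H and
  2i on V.\<close>

definition beta :: "'n::finite T \<Rightarrow> 'n T \<Rightarrow> real" where
  "beta X Y = g_hor (endJ X) Y + 2 * g_ver (endJ X) Y"

lemma sp_form_bilinear: "sp_form a \<Longrightarrow> bilinear a"
  unfolding sp_form_def by blast

lemma sp_form_skew: "sp_form a \<Longrightarrow> a y x = - a x y"
  unfolding sp_form_def by blast

lemma sp_form_i: "sp_form a \<Longrightarrow> a (\<i> *s x) (\<i> *s y) = a x y"
  unfolding sp_form_def by blast

lemma sp_form_qj: "sp_form a \<Longrightarrow> a (qj x) (qj y) = a x y"
  unfolding sp_form_def by blast

lemma sp_form_i_left: "sp_form a \<Longrightarrow> a (\<i> *s x) y = - a x (\<i> *s y)"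
  using sp_form_i[of a x "\<i> *s y"] by (simp add: bilinear_rneg sp_form_bilinear)

lemma sp_form_qj_left: "sp_form a \<Longrightarrow> a (qj x) y = - a x (qj y)"
  using sp_form_qj[of a x "qj y"] by (simp add: bilinear_rneg sp_form_bilinear)

section \<open>Unitary matrices and Sp(n)\<close>

lemma inner_eq_herm: "x \<bullet> y = Re (\<Sum>i\<in>UNIV. x $ i * cnj (y $ i))" for x y :: "complex ^ 'm"
  by (simp add: inner_vec_def inner_complex_def)

lemma unitary_inner:
  fixes a :: "complex ^ 'm ^ 'm"
  assumes "a \<in> unitary_matrices"
  shows "(a *v x) \<bullet> (a *v y) = x \<bullet> y" and "surj ((*v) a)" and "inj ((*v) a)"
proof -
  define b where "b = transpose (map_matrix cnj a)"
  have ab: "a ** b = mat 1" using assms by (simp add: unitary_matrices_def b_def)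
  then have ba: "b ** a = mat 1" by (simp add: matrix_left_right_inverse)
  have adj: "(a *v x) \<bullet> z = x \<bullet> (b *v z)" for x z
  proof -
    have "(\<Sum>i\<in>UNIV. (a *v x) $ i * cnj (z $ i)) = (\<Sum>i\<in>UNIV. \<Sum>j\<in>UNIV. a $ i $ j * x $ j * cnj (z $ i))"
      by (simp add: matrix_vector_mult_def sum_distrib_right)
    also have "\<dots> = (\<Sum>j\<in>UNIV. \<Sum>i\<in>UNIV. a $ i $ j * x $ j * cnj (z $ i))"
      by (rule sum.swap)
    also have "\<dots> = (\<Sum>j\<in>UNIV. x $ j * cnj ((b *v z) $ j))"
      by (rule sum.cong[OF refl])
        (simp add: matrix_vector_mult_def b_def transpose_def map_matrix_def sum_distrib_left mult_ac)
    finally show ?thesis by (simp add: inner_eq_herm)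
  qed
  show "(a *v x) \<bullet> (a *v y) = x \<bullet> y"
    by (simp add: adj matrix_vector_mul_assoc ba)
  show "surj ((*v) a)"
    by (metis ab matrix_vector_mul_assoc matrix_vector_mul_lid surjI)
  show "inj ((*v) a)"
    by (metis ba matrix_vector_mul_assoc matrix_vector_mul_lid injI)
qed

text \<open>A complex matrix commutes with i, so the imaginary part of the Hermitian product is also
  preserved: it is the real inner product of x with i y.\<close>

lemma unitary_matricesI:
  fixes a :: "complex ^ 'm ^ 'm"
  assumes "\<And>x y. (a *v x) \<bullet> (a *v y) = x \<bullet> y"
  shows "a \<in> unitary_matrices"
proof -
  define b where "b = transpose (map_matrix cnj a)"
  have herm: "(\<Sum>k\<in>UNIV. (a *v x) $ k * cnj ((a *v y) $ k)) = (\<Sum>k\<in>UNIV. x $ k * cnj (y $ k))" for x y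
  proof -
    have im: "Im (\<Sum>k\<in>UNIV. u $ k * cnj (v $ k)) = u \<bullet> (\<i> *s v)" for u v :: "complex ^ 'm"
      by (simp add: inner_vec_def inner_complex_def algebra_simps)
    have "a *v (\<i> *s y) = \<i> *s (a *v y)"
      by (simp add: vector_scalar_commute)
    then show ?thesis
      using assms[of x y] assms[of x "\<i> *s y"] by (simp add: complex_eq_iff inner_eq_herm[symmetric] im del: Re_sum Im_sum)
  qed
  have "b ** a = mat 1"
  proof (rule vec_eq_iff[THEN iffD2], rule allI, rule vec_eq_iff[THEN iffD2], rule allI)
    fix i j
    have col: "(a *v axis m 1) $ k = a $ k $ m" for m k
      by (simp add: matrix_vector_mult_def axis_def if_distrib cong: if_cong)
    have "(b ** a) $ i $ j = (\<Sum>k\<in>UNIV. (a *v axis j 1) $ k * cnj ((a *v axis i 1) $ k))"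
      by (simp add: matrix_matrix_mult_def b_def transpose_def map_matrix_def col mult.commute)
    also have "\<dots> = (\<Sum>k\<in>UNIV. if k = j then cnj (axis i 1 $ k) else 0)"
      unfolding herm by (rule sum.cong[OF refl]) (simp add: axis_def)
    also have "\<dots> = mat 1 $ i $ j"
      by (simp add: axis_def mat_def)
    finally show "(b ** a) $ i $ j = mat 1 $ i $ j" .
  qed
  then show ?thesis
    by (simp add: unitary_matrices_def b_def matrix_left_right_inverse)
qed

text \<open>The real and imaginary parts of 2 \<open>omega0\<close> are g(\<open>qj\<close> x, y)
  and g(i \<open>qj\<close> x, y); for a surjective isometry that commutes with i, preserving them
  means commuting with \<open>qj\<close>.\<close>

lemma Sp_iff:
  "a \<in> Sp \<longleftrightarrow> a \<in> unitary_matrices \<and> (\<forall>x. a *v qj x = qj (a *v x))"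
proof
  assume a: "a \<in> Sp"
  then have U: "a \<in> unitary_matrices" by (simp add: Sp_def)
  have "a *v qj x = qj (a *v x)" for x
  proof -
    have "(a *v qj x) \<bullet> z = qj (a *v x) \<bullet> z" for z
    proof -
      obtain y where z: "z = a *v y" using unitary_inner(2)[OF U] by blast
      have "omega0 (a *v x, 0) (a *v y, 0) = omega0 (x, 0) (y, 0)"
        using a by (simp add: Sp_def)
      then have "qj (a *v x) \<bullet> (a *v y) = qj x \<bullet> y"
        by (simp add: omega0_eq)
      then show ?thesis by (simp add: z unitary_inner(1)[OF U])
    qed
    then show ?thesis by (metis vector_eq_rdot)
  qed
  with U show "a \<in> unitary_matrices \<and> (\<forall>x. a *v qj x = qj (a *v x))" by blast
next
  assume "a \<in> unitary_matrices \<and> (\<forall>x. a *v qj x = qj (a *v x))"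
  then have U: "a \<in> unitary_matrices" and q: "\<And>x. qj (a *v x) = a *v qj x" by auto
  have "\<i> *s (a *v x) = a *v (\<i> *s x)" for x by (simp add: vector_scalar_commute)
  then show "a \<in> Sp" by (simp add: Sp_def U omega0_eq q unitary_inner(1)[OF U])
qed

section \<open>The Lie algebra of the group\<close>

lemma linear_endJ: "linear endJ"
  by (rule linearI) (simp_all add: endJ_def vec_i_linear algebra_simps)

lemma inner_endJ: "endJ X \<bullet> Y = - (X \<bullet> endJ Y)"
  by (simp add: endJ_def inner_prod_def inner_i_left inner_complex_def)

lemma beta_eq: "beta X Y = (\<i> *s fst X) \<bullet> fst Y + 2 * ((\<i> * snd X) \<bullet> snd Y)"
  by (simp add: beta_def g_hor_def g_ver_def endJ_def)

lemma bounded_bilinear_vec_scale: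
  "bounded_bilinear (\<lambda>c (x :: complex ^ 'm). c *s x)"
  unfolding bilinear_conv_bounded_bilinear[symmetric] bilinear_def
  by (auto intro!: linearI simp: vec_eq_iff algebra_simps)

text \<open>Conditions that do not mention a and b, ready to be differentiated along a curve. In the
  last one, a commutes with \<open>qj\<close> while the antilinear \<open>qj\<close> turns b into
  \<open>cnj b\<close> = 1/b; the factor b^2, which is the action on V, compensates.\<close>

lemma rho_groupD:
  assumes "h \<in> rho_group"
  shows "linear h" and "h X \<bullet> h Y = X \<bullet> Y" and "h (endJ X) = endJ (h X)"
    and "fst (h (0, v)) = 0" and "snd (h (x, 0)) = 0"
    and "fst (h (qj x, 0)) = snd (h (0, 1)) *s qj (fst (h (x, 0)))"
proof -
  from assms obtain a b where h: "h = rho a b" and a: "a \<in> Sp" and b: "cmod b = 1"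
    by (auto simp: rho_group_def U1_def)
  have U: "a \<in> unitary_matrices" and q: "a *v qj x = qj (a *v x)" for x
    using a by (simp_all add: Sp_iff)
  have bb: "b * cnj b = 1" using b complex_norm_square[of b] by simp
  have ub: "(b *s x) \<bullet> (b *s y) = x \<bullet> y" for x y :: "complex ^ 'm"
    using inner_scale_scale[of "cnj b" x "cnj b" y] b dot_square_norm[of b]
    by (simp add: inner_complex_def mult.commute)
  have ub': "(b\<^sup>2 * v) \<bullet> (b\<^sup>2 * w) = v \<bullet> w" for v w
  proof -
    have "(b\<^sup>2 * v) * cnj (b\<^sup>2 * w) = (b * cnj b)\<^sup>2 * (v * cnj w)"
      by (simp add: power2_eq_square)
    moreover have dot: "x \<bullet> y = Re (x * cnj y)" for x y :: complex by (simp add: inner_complex_def)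
    ultimately show ?thesis unfolding dot by (simp only: bb power_one mult_1)
  qed
  have aR: "a *v (r *\<^sub>R x) = r *\<^sub>R (a *v x)" for r x
    by (simp add: vec_complex_scaleR[symmetric] vector_scalar_commute)
  show "linear h" unfolding h rho_def
    by (rule linearI)
      (simp_all add: matrix_vector_right_distrib vec.scale_right_distrib algebra_simps
        aR vec_eq_iff)
  show "h X \<bullet> h Y = X \<bullet> Y"
    by (simp add: h rho_def inner_prod_def ub ub' unitary_inner(1)[OF U])
  show "h (endJ X) = endJ (h X)"
    by (simp add: h rho_def endJ_def vector_scalar_commute mult_ac)
  show "fst (h (0, v)) = 0" "snd (h (x, 0)) = 0"
    by (simp_all add: h rho_def)
  show "fst (h (qj x, 0)) = snd (h (0, 1)) *s qj (fst (h (x, 0)))"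
    using bb by (simp add: h rho_def q power2_eq_square mult.assoc)
qed

lemma lie_algebra_rho_groupD:
  fixes A :: "'n::finite T \<Rightarrow> 'n T"
  assumes "A \<in> lie_algebra rho_group"
  obtains a s where "sp_form a" "\<And>X Y. A X \<bullet> Y = a (fst X) (fst Y) + s * beta X Y"
proof -
  from assms obtain \<gamma> where G: "\<And>t. \<gamma> t \<in> rho_group" and \<gamma>0: "\<gamma> 0 = id"
    and D: "\<And>X. ((\<lambda>t. \<gamma> t X) has_vector_derivative A X) (at 0)"
    unfolding lie_algebra_def by blast
  note P = rho_groupD[OF G]
  note uniq = vector_derivative_unique_at
  have add: "A (X + Y) = A X + A Y" for X Y
    by (rule uniq[OF D]) (simp add: linear_add[OF P(1)] D has_vector_derivative_add)
  have scale: "A (r *\<^sub>R X) = r *\<^sub>R A X" for r X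
    by (rule uniq[OF D])
      (simp add: linear_scale[OF P(1)] D bounded_linear.has_vector_derivative[OF bounded_linear_scaleR_right])
  have AJ: "A (endJ X) = endJ (A X)" for X
    by (rule uniq[OF D])
      (simp add: P(3) D bounded_linear.has_vector_derivative[OF linear_conv_bounded_linear[THEN iffD1, OF linear_endJ]])
  have f0: "fst (A (0, v)) = 0" for v
  proof -
    have "((\<lambda>t. fst (\<gamma> t (0, v))) has_vector_derivative fst (A (0, v))) (at 0)"
      by (rule bounded_linear.has_vector_derivative[OF bounded_linear_fst D])
    then show ?thesis unfolding P(4) using has_vector_derivative_const uniq by blast
  qed
  have s0: "snd (A (x, 0)) = 0" for x
  proof -
    have "((\<lambda>t. snd (\<gamma> t (x, 0))) has_vector_derivative snd (A (x, 0))) (at 0)"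
      by (rule bounded_linear.has_vector_derivative[OF bounded_linear_snd D])
    then show ?thesis unfolding P(5) using has_vector_derivative_const uniq by blast
  qed
  have skew: "A X \<bullet> Y = - (X \<bullet> A Y)" for X Y
  proof -
    have "((\<lambda>t. \<gamma> t X \<bullet> \<gamma> t Y) has_vector_derivative (\<gamma> 0 X \<bullet> A Y + A X \<bullet> \<gamma> 0 Y)) (at 0)"
      by (rule bounded_bilinear.has_vector_derivative[OF bounded_bilinear_inner D D])
    then have "X \<bullet> A Y + A X \<bullet> Y = 0"
      unfolding P(2) \<gamma>0 id_apply using has_vector_derivative_const uniq by blast
    then show ?thesis by simp
  qed
  \<comment> \<open>c is the velocity of b^2 on V. It is purely imaginary because A is skew, and
    \<open>beta\<close> corresponds to 2i on V, so Im c / 2 is the coefficient of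
    \<open>beta\<close>.\<close>
  define c where "c = snd (A (0, 1))"
  define s where "s = Im c / 2"
  have "A (0, 1) \<bullet> (0, 1) = 0" using skew[of "(0, 1)" "(0, 1)"] by (simp add: inner_commute)
  then have "Re c = 0" by (simp add: inner_prod_def c_def inner_complex_def)
  then have c: "c = 2 * s * \<i>" by (simp add: s_def complex_eq_iff)
  have snd_A: "snd (A (0, v)) = v * c" for v
  proof -
    have "(0 :: 'n E, v) = Re v *\<^sub>R (0, 1) + Im v *\<^sub>R endJ (0, 1)"
      by (simp add: endJ_def complex_eq_iff vec_i_linear)
    then have "A (0, v) = Re v *\<^sub>R A (0, 1) + Im v *\<^sub>R endJ (A (0, 1))"
      by (simp only: add scale AJ)
    then show ?thesis by (simp add: endJ_def c_def[symmetric] complex_eq_iff)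
  qed
  define B where "B x = fst (A (x, 0))" for x
  \<comment> \<open>Product rule for the last identity of \<open>rho_groupD\<close>: at t = 0 the
    scalar is 1 with velocity c.\<close>
  have Bq: "B (qj x) = c *s qj x + qj (B x)" for x
  proof -
    have 1: "((\<lambda>t. snd (\<gamma> t (0, 1))) has_vector_derivative c) (at 0)"
      unfolding c_def by (rule bounded_linear.has_vector_derivative[OF bounded_linear_snd D])
    have 2: "((\<lambda>t. fst (\<gamma> t (y, 0))) has_vector_derivative B y) (at 0)" for y
      unfolding B_def by (rule bounded_linear.has_vector_derivative[OF bounded_linear_fst D])
    have 3: "((\<lambda>t. qj (fst (\<gamma> t (x, 0)))) has_vector_derivative qj (B x)) (at 0)"
      by (rule bounded_linear.has_vector_derivative[OF linear_conv_bounded_linear[THEN iffD1, OF linear_qj] 2])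
    have "((\<lambda>t. fst (\<gamma> t (qj x, 0))) has_vector_derivative 1 *s qj (B x) + c *s qj x) (at 0)"
      unfolding P(6) using bounded_bilinear.has_vector_derivative[OF bounded_bilinear_vec_scale 1 3]
      by (simp add: \<gamma>0)
    from uniq[OF 2 this] show ?thesis by (simp add: add.commute)
  qed
  have Bi: "B (\<i> *s x) = \<i> *s B x" for x
    using AJ[of "(x, 0)"] by (simp add: B_def endJ_def)
  have Blin: "B (x + y) = B x + B y" "B (r *\<^sub>R x) = r *\<^sub>R B x" for x y r
    using add[of "(x, 0)" "(y, 0)"] scale[of r "(x, 0)"] by (simp_all add: B_def)
  have Bskew: "B y \<bullet> x = - (B x \<bullet> y)" for x y
    using skew[of "(y, 0)" "(x, 0)"] by (simp add: B_def inner_prod_def inner_commute)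
  have cs: "c *s x = (2 * s) *\<^sub>R (\<i> *s x)" for x :: "'n E"
    by (simp add: c vec_eq_iff complex_eq_iff)
  \<comment> \<open>As i anticommutes with \<open>qj\<close>, subtracting s i from B removes exactly
    the defect c \<open>qj\<close> x = 2 s i \<open>qj\<close> x.\<close>
  define a where "a x y = B x \<bullet> y - s * ((\<i> *s x) \<bullet> y)" for x y
  show thesis
  proof
    show "sp_form a" unfolding sp_form_def
    proof (intro conjI allI)
      show "bilinear a" unfolding bilinear_def a_def
        by (auto intro!: linearI simp: Blin vec_i_linear inner_add_left inner_add_right algebra_simps)
      show "a y x = - a x y" for x y
      proof -
        have "(\<i> *s y) \<bullet> x = - ((\<i> *s x) \<bullet> y)" using inner_i_left[of x y] by (simp add: inner_commute)
        then show ?thesis by (simp add: a_def Bskew[of y x])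
      qed
      show "a (\<i> *s x) (\<i> *s y) = a x y" for x y
        by (simp add: a_def Bi inner_i_i inner_i_left[of x])
      show "a (qj x) (qj y) = a x y" for x y
      proof -
        have "\<i> *s qj x = - qj (\<i> *s x)" by (simp add: vec_i_linear)
        then have "(\<i> *s qj x) \<bullet> qj y = - ((\<i> *s x) \<bullet> y)"
          using inner_qj_qj[of "\<i> *s x" y] by simp
        then show ?thesis
          by (simp add: a_def Bq cs inner_add_left inner_qj_qj)
      qed
    qed
    show "A X \<bullet> Y = a (fst X) (fst Y) + s * beta X Y" for X Y
    proof -
      have "A X = A (fst X, 0) + A (0, snd X)"
        unfolding add[symmetric] by simp
      also have "\<dots> = (B (fst X), snd X * c)"
        by (simp add: prod_eq_iff B_def f0 s0 snd_A)
      finally show ?thesis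
        by (simp add: a_def beta_eq inner_prod_def c inner_complex_def algebra_simps)
    qed
  qed
qed


text \<open>C t is (1 - tA)^(-1) (1 + tA), where 1 - tA is injective because <A y, y> = 0. The
  defining equation is exported rather than the formula, so that symmetries of A pass to C t by
  uniqueness of the solution.\<close>

lemma cayley_transform:
  fixes A :: "'a::euclidean_space \<Rightarrow> 'a"
  assumes A: "linear A" and skew: "\<And>x y. A x \<bullet> y = - (x \<bullet> A y)"
  obtains C where "\<And>t x y. y - x = t *\<^sub>R A (y + x) \<longleftrightarrow> y = C t x"
    and "\<And>t x y. C t x \<bullet> C t y = x \<bullet> y"
    and "\<And>x. ((\<lambda>t. C t x) has_vector_derivative 2 *\<^sub>R A x) (at 0)"
proof -
  have ex1: "\<exists>!y. y - x = t *\<^sub>R A (y + x)" for t x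
  proof -
    define m where "m y = y - t *\<^sub>R A y" for y
    have lin: "linear m"
      by (rule linearI) (simp_all add: m_def linear_add[OF A] linear_scale[OF A] algebra_simps)
    have "y = 0" if "m y = 0" for y
    proof -
      have "A y \<bullet> y = 0" using skew[of y y] by (simp add: inner_commute)
      then have "m y \<bullet> y = y \<bullet> y" by (simp add: m_def inner_diff_left)
      with that show ?thesis by simp
    qed
    then have inj: "inj m" using linear_injective_0[OF lin] by blast
    have "surj m" using linear_injective_imp_surjective[OF lin inj] by simp
    then obtain y where "m y = x + t *\<^sub>R A x" by (metis surjD)
    moreover have "y - x = t *\<^sub>R A (y + x) \<longleftrightarrow> m y = x + t *\<^sub>R A x" for y
      by (auto simp: m_def linear_add[OF A] algebra_simps)
    ultimately show ?thesis using inj by (metis injD)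
  qed
  define C where "C t x = (THE y. y - x = t *\<^sub>R A (y + x))" for t x
  have C: "C t x - x = t *\<^sub>R A (C t x + x)" for t x
    unfolding C_def by (rule theI'[OF ex1])
  have iff: "y - x = t *\<^sub>R A (y + x) \<longleftrightarrow> y = C t x" for t x y
    using ex1 C by metis
  have iso: "C t x \<bullet> C t y = x \<bullet> y" for t x y
  proof -
    \<comment> \<open>Polarised form of |y|^2 - |x|^2 = <y - x, y + x>; after inserting the defining
      equation the two products cancel by skewness.\<close>
    have "2 * (C t x \<bullet> C t y - x \<bullet> y) =
        (C t x - x) \<bullet> (C t y + y) + (C t x + x) \<bullet> (C t y - y)"
      by (simp add: inner_diff_left inner_diff_right inner_add_left inner_add_right)
    also have "\<dots> = 0"
      unfolding C[of t x] C[of t y] by (simp add: skew)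
    finally show ?thesis by simp
  qed
  have der: "((\<lambda>t. C t x) has_vector_derivative 2 *\<^sub>R A x) (at 0)" for x
  proof -
    obtain K where K: "\<And>x. norm (A x) \<le> norm x * K"
      using bounded_linear.bounded[OF A[unfolded linear_conv_bounded_linear]] by blast
    have C0: "C 0 x = x" using C[of 0 x] by simp
    have nC: "norm (C t x) = norm x" for t
      using iso[of t x x] by (simp add: norm_eq_sqrt_inner)
    \<comment> \<open>The remainder of the difference quotient will be \<open>A (C t x - x)\<close>
      up to sign-free norm, so continuity at 0 suffices; it follows from the defining equation, as
      \<open>C t x\<close> has constant norm.\<close>
    have bd: "norm (C t x - x) \<le> \<bar>t\<bar> * (2 * norm x * \<bar>K\<bar>)" for t
    proof -
      have "norm (A (C t x + x)) \<le> norm (C t x + x) * \<bar>K\<bar>"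
        using K[of "C t x + x"] by (meson abs_ge_self mult_left_mono norm_ge_zero order_trans)
      also have "\<dots> \<le> 2 * norm x * \<bar>K\<bar>"
        using norm_triangle_ineq[of "C t x" x] nC by (intro mult_right_mono) auto
      finally show ?thesis
        unfolding C[of t x] by (simp add: mult_left_mono)
    qed
    have "((\<lambda>t. C t x - x) \<longlongrightarrow> 0) (at 0)"
    proof (rule Lim_null_comparison)
      show "\<forall>\<^sub>F t in at 0. norm (C t x - x) \<le> \<bar>t\<bar> * (2 * norm x * \<bar>K\<bar>)"
        using bd by simp
      show "((\<lambda>t. \<bar>t\<bar> * (2 * norm x * \<bar>K\<bar>)) \<longlongrightarrow> 0) (at 0)"
        by (auto intro!: tendsto_eq_intros)
    qed
    then have "((\<lambda>t. A (C t x - x)) \<longlongrightarrow> 0) (at 0)"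
      using bounded_linear.tendsto_zero A linear_conv_bounded_linear by blast
    then have lim: "((\<lambda>t. norm (A (C t x - x))) \<longlongrightarrow> 0) (at 0)"
      by (rule tendsto_norm_zero)
    have "((\<lambda>t. norm (C t x - C 0 x - (t - 0) *\<^sub>R (2 *\<^sub>R A x)) / norm (t - 0)) \<longlongrightarrow> 0) (at 0)"
    proof (rule Lim_transform_eventually[OF lim])
      have "C t x - C 0 x - (t - 0) *\<^sub>R (2 *\<^sub>R A x) = t *\<^sub>R A (C t x - x)" for t
      proof -
        have "C t x - x - t *\<^sub>R (2 *\<^sub>R A x) = t *\<^sub>R A (C t x + x) - t *\<^sub>R (2 *\<^sub>R A x)"
          by (simp only: C[of t x])
        then show ?thesis
          by (simp add: C0 linear_add[OF A] linear_diff[OF A] algebra_simps scaleR_2)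
      qed
      then show "\<forall>\<^sub>F t in at 0. norm (A (C t x - x)) =
          norm (C t x - C 0 x - (t - 0) *\<^sub>R (2 *\<^sub>R A x)) / norm (t - 0)"
        unfolding eventually_at by (intro exI[of _ 1]) simp
    qed
    then show ?thesis
      unfolding has_vector_derivative_def has_derivative_iff_norm
      using bounded_linear_scaleR_left[of "2 *\<^sub>R A x"] by simp
  qed
  show thesis by (rule that[OF iff iso der])
qed

lemma sp_form_in_rho_forms:
  fixes a :: "'n::finite E \<Rightarrow> 'n E \<Rightarrow> real"
  assumes a: "sp_form a"
  shows "(\<lambda>X Y. a (fst X) (fst Y) + s * beta X Y) \<in> rho_forms"
proof -
  note bil = sp_form_bilinear[OF a]
  \<comment> \<open>Half of the operator dual to a, because the Cayley curve has velocity 2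
    A.\<close>
  define A where "A x = (1/2) *\<^sub>R riesz (a x)" for x
  have A: "A x \<bullet> y = a x y / 2" for x y
    using bil by (simp add: A_def riesz_inner bilinear_def)
  have linA: "linear A"
    by (rule linearI; subst vector_eq_rdot[symmetric])
      (simp_all add: A inner_add_left bilinear_ladd[OF bil] bilinear_lmul[OF bil] add_divide_distrib)
  have skewA: "A x \<bullet> y = - (x \<bullet> A y)" for x y
    using sp_form_skew[OF a, of x y] by (simp add: A inner_commute[of x])
  have Ai: "A (\<i> *s x) = \<i> *s A x" for x
    by (subst vector_eq_rdot[symmetric]) (simp add: A inner_i_left sp_form_i_left[OF a])
  have Aq: "A (qj x) = qj (A x)" for x
    by (subst vector_eq_rdot[symmetric]) (simp add: A inner_qj_left sp_form_qj_left[OF a])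
  obtain C where C: "\<And>t x y. y - x = t *\<^sub>R A (y + x) \<longleftrightarrow> y = C t x"
    and iso: "\<And>t x y. C t x \<bullet> C t y = x \<bullet> y"
    and der: "\<And>x. ((\<lambda>t. C t x) has_vector_derivative 2 *\<^sub>R A x) (at 0)"
    using cayley_transform[OF linA skewA] by blast
  have C': "C t x - x = t *\<^sub>R A (C t x + x)" for t x using C by blast
  \<comment> \<open>Here and in the next three facts, both sides solve the equation that determines
    \<open>C t\<close>.\<close>
  have Cadd: "C t (x + y) = C t x + C t y" for t x y
  proof -
    have "(C t x + C t y) - (x + y) = (C t x - x) + (C t y - y)" by simp
    also have "\<dots> = t *\<^sub>R A ((C t x + C t y) + (x + y))"
      unfolding C' by (simp add: linear_add[OF linA] algebra_simps)
    finally show ?thesis using C by metis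
  qed
  have CR: "C t (r *\<^sub>R x) = r *\<^sub>R C t x" for t r x
  proof -
    have "r *\<^sub>R C t x - r *\<^sub>R x = r *\<^sub>R (t *\<^sub>R A (C t x + x))"
      unfolding C'[symmetric] by (simp add: algebra_simps)
    also have "\<dots> = t *\<^sub>R A (r *\<^sub>R C t x + r *\<^sub>R x)"
      by (simp add: linear_add[OF linA] linear_scale[OF linA] algebra_simps)
    finally show ?thesis using C by metis
  qed
  have Ci: "C t (\<i> *s x) = \<i> *s C t x" for t x
  proof -
    have "\<i> *s C t x - \<i> *s x = \<i> *s (t *\<^sub>R A (C t x + x))"
      unfolding C'[symmetric] by (simp add: vec_i_linear)
    also have "\<dots> = t *\<^sub>R A (\<i> *s C t x + \<i> *s x)"
      by (simp add: vec_i_linear(4) Ai[symmetric] vec_i_linear(1))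
    finally show ?thesis using C by metis
  qed
  have Cq: "C t (qj x) = qj (C t x)" for t x
  proof -
    have "qj (C t x) - qj x = qj (t *\<^sub>R A (C t x + x))"
      unfolding C'[symmetric] by simp
    also have "\<dots> = t *\<^sub>R A (qj (C t x) + qj x)"
      by (simp add: Aq[symmetric])
    finally show ?thesis using C by metis
  qed
  have Cs: "C t (c *s x) = c *s C t x" for t c x
    by (simp add: vec_complex_split[of c] Cadd CR Ci)
  define M where "M t = matrix (C t)" for t
  have M: "M t *v x = C t x" for t x
    unfolding M_def
    by (rule matrix_works) (simp add: Vector_Spaces.linear_iff Cadd Cs vec.vector_space_axioms)
  have "M t \<in> Sp" for t
    unfolding Sp_iff using unitary_matricesI[of "M t"] by (simp add: M iso Cq)
  then have mem: "rho (M t) (cis (s * t)) \<in> rho_group" for t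
    unfolding rho_group_def U1_def by (auto intro!: exI[of _ "M t"] exI[of _ "cis (s * t)"])
  \<comment> \<open>The velocity in the shape given by the product rule: \<open>1 *s\<close> stands
    for the value of \<open>cis\<close> at 0, and squaring \<open>cis (s * t)\<close> gives 2 s on
    V.\<close>
  define V where "V X = (1 *s (2 *\<^sub>R A (fst X)) + (of_real s * \<i>) *s fst X, (2 * of_real s * \<i>) * snd X)" for X
  have cis_der: "((\<lambda>t. cis (r * t)) has_vector_derivative (of_real r * \<i>)) (at 0)" for r
    by (auto simp: has_vector_derivative_complex_iff intro!: derivative_eq_intros)
  have "V \<in> lie_algebra rho_group"
    unfolding lie_algebra_def
  proof (intro CollectI exI conjI allI)
    show "rho (M t) (cis (s * t)) \<in> rho_group" for t by (rule mem)
    have "C 0 x = x" for x using C'[of 0 x] by simp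
    then show "rho (M 0) (cis (s * 0)) = id"
      by (auto simp: rho_def M fun_eq_iff)
    fix X :: "'n T"
    have "((\<lambda>t. cis (s * t) *s C t (fst X)) has_vector_derivative
        (cis (s * 0) *s (2 *\<^sub>R A (fst X)) + (of_real s * \<i>) *s C 0 (fst X))) (at 0)"
      by (rule bounded_bilinear.has_vector_derivative[OF bounded_bilinear_vec_scale cis_der der])
    moreover have "((\<lambda>t. cis ((2 * s) * t) * snd X) has_vector_derivative
        (of_real (2 * s) * \<i>) * snd X) (at 0)"
      by (rule has_vector_derivative_mult_left[OF cis_der])
    moreover have "(cis (s * t))\<^sup>2 = cis ((2 * s) * t)" for t
      by (simp add: power2_eq_square cis_mult mult.assoc)
    ultimately show "((\<lambda>t. rho (M t) (cis (s * t)) X) has_vector_derivative V X) (at 0)"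
      using has_vector_derivative_Pair \<open>\<And>x. C 0 x = x\<close> by (fastforce simp: rho_def M V_def)
  qed
  moreover have "(of_real s * \<i>) *s x = s *\<^sub>R (\<i> *s x)" for x :: "'n E"
    by (simp add: vec_eq_iff complex_eq_iff)
  then have "V X \<bullet> Y = a (fst X) (fst Y) + s * beta X Y" for X Y
    by (simp add: V_def inner_prod_def inner_add_left A beta_eq inner_complex_def)
      (simp add: algebra_simps)
  ultimately show ?thesis
    unfolding rho_forms_def by (intro CollectI exI[of _ V]) (simp add: fun_eq_iff)
qed

lemma rho_forms_eq: "rho_forms = {(\<lambda>X Y. a (fst X) (fst Y) + s * beta X Y) | a s. sp_form a}"
proof
  show "rho_forms \<subseteq> {(\<lambda>X Y. a (fst X) (fst Y) + s * beta X Y) | a s. sp_form a}"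
    unfolding rho_forms_def by (auto elim!: lie_algebra_rho_groupD simp: fun_eq_iff) (metis)
qed (use sp_form_in_rho_forms in blast)

section \<open>Symmetric squares\<close>

type_synonym 'n hor4 = "'n E \<Rightarrow> 'n E \<Rightarrow> 'n E \<Rightarrow> 'n E \<Rightarrow> real"

text \<open>S^2(sp(n)) described by symmetries instead of sums of products;
  \<open>hlift_in_sym_square\<close> shows that nothing is added.\<close>

definition sp_square :: "'n::finite hor4 \<Rightarrow> bool" where
  "sp_square r \<longleftrightarrow> (\<forall>z w. sp_form (\<lambda>x y. r x y z w)) \<and> (\<forall>x y z w. r x y z w = r z w x y)"

text \<open>Hyper-Kaehler curvature tensors on the horizontal space: the operators lie in sp(n).\<close>

definition hk :: "'n::finite hor4 \<Rightarrow> bool" where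
  "hk r \<longleftrightarrow> sp_square r \<and> (\<forall>x y z w. r x y z w + r y z x w + r z x y w = 0)"

definition hlift :: "'n::finite hor4 \<Rightarrow> 'n tensor4" where
  "hlift r X Y Z W = r (fst X) (fst Y) (fst Z) (fst W)"

lemma sp_square_sp_form_left: "sp_square r \<Longrightarrow> sp_form (\<lambda>x y. r x y z w)"
  unfolding sp_square_def by blast

lemma sp_square_swap: "sp_square r \<Longrightarrow> r x y z w = r z w x y"
  unfolding sp_square_def by blast

lemma sp_square_sp_form_right:
  assumes "sp_square r"
  shows "sp_form (\<lambda>z w. r x y z w)"
proof -
  have "(\<lambda>z w. r x y z w) = (\<lambda>z w. r z w x y)"
    by (intro ext sp_square_swap[OF assms])
  then show ?thesis using sp_square_sp_form_left[OF assms, of x y] by simp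
qed

lemma sp_form_sum:
  assumes "\<And>i. i \<in> I \<Longrightarrow> sp_form (a i)"
  shows "sp_form (\<lambda>x y. \<Sum>i\<in>I. a i x y * c i)"
proof -
  have b: "bilinear (a i)" if "i \<in> I" for i
    using assms[OF that] by (rule sp_form_bilinear)
  show ?thesis
    unfolding sp_form_def bilinear_def
  proof (intro conjI allI linearI)
    show "(\<Sum>i\<in>I. a i x (y + z) * c i) = (\<Sum>i\<in>I. a i x y * c i) + (\<Sum>i\<in>I. a i x z * c i)" for x y z
      unfolding sum.distrib[symmetric] by (rule sum.cong) (simp_all add: bilinear_radd[OF b] algebra_simps)
    show "(\<Sum>i\<in>I. a i (x + y) z * c i) = (\<Sum>i\<in>I. a i x z * c i) + (\<Sum>i\<in>I. a i y z * c i)" for x y z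
      unfolding sum.distrib[symmetric] by (rule sum.cong) (simp_all add: bilinear_ladd[OF b] algebra_simps)
    show "(\<Sum>i\<in>I. a i x (r *\<^sub>R y) * c i) = r *\<^sub>R (\<Sum>i\<in>I. a i x y * c i)" for x y r
      unfolding real_scaleR_def sum_distrib_left by (rule sum.cong) (simp_all add: bilinear_rmul[OF b])
    show "(\<Sum>i\<in>I. a i (r *\<^sub>R x) y * c i) = r *\<^sub>R (\<Sum>i\<in>I. a i x y * c i)" for x y r
      unfolding real_scaleR_def sum_distrib_left by (rule sum.cong) (simp_all add: bilinear_lmul[OF b])
    show "(\<Sum>i\<in>I. a i y x * c i) = - (\<Sum>i\<in>I. a i x y * c i)" for x y
      unfolding sum_negf[symmetric]
    proof (rule sum.cong)
      fix i assume "i \<in> I"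
      then show "a i y x * c i = - (a i x y * c i)" using sp_form_skew[OF assms, of i y x] by simp
    qed simp
  qed (auto intro!: sum.cong simp: sp_form_i[OF assms] sp_form_qj[OF assms])
qed

lemma sp_form_add:
  assumes "sp_form a" "sp_form b"
  shows "sp_form (\<lambda>x y. a x y + b x y)"
  using sp_form_sum[of "UNIV :: bool set" "\<lambda>i. if i then a else b" "\<lambda>_. 1"] assms
  by (simp add: UNIV_bool add.commute)

lemma sp_form_scale:
  assumes "sp_form a"
  shows "sp_form (\<lambda>x y. c * a x y)"
  using sp_form_sum[of "{()}" "\<lambda>_. a" "\<lambda>_. c"] assms by (simp add: mult.commute)

lemma sp_form_zero: "sp_form a \<Longrightarrow> a 0 y = 0" "sp_form a \<Longrightarrow> a x 0 = 0"
  by (simp_all add: bilinear_lzero bilinear_rzero sp_form_bilinear)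

lemma sp_square_add:
  assumes "sp_square r" "sp_square s"
  shows "sp_square (\<lambda>x y z w. r x y z w + s x y z w)"
  unfolding sp_square_def
proof (intro conjI allI)
  show "r x y z w + s x y z w = r z w x y + s z w x y" for x y z w
    using sp_square_swap[OF assms(1), of x y z w] sp_square_swap[OF assms(2), of x y z w] by linarith
qed (intro sp_form_add sp_square_sp_form_left assms)

lemma sp_square_scale:
  assumes "sp_square r"
  shows "sp_square (\<lambda>x y z w. c * r x y z w)"
  unfolding sp_square_def
proof (intro conjI allI)
  show "c * r x y z w = c * r z w x y" for x y z w
    by (intro arg_cong[of _ _ "(*) c"] sp_square_swap[OF assms])
qed (intro sp_form_scale sp_square_sp_form_left assms)

lemma sym_square_sum:
  assumes "finite I" "\<And>i. i \<in> I \<Longrightarrow> \<alpha> i \<in> h" "\<And>i. i \<in> I \<Longrightarrow> \<beta> i \<in> h"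
  shows "(\<lambda>X Y Z W. \<Sum>i\<in>I. \<alpha> i X Y * \<beta> i Z W + \<beta> i X Y * \<alpha> i Z W) \<in> sym_square h"
proof -
  obtain f where f: "bij_betw f {..<card I} I"
    using ex_bij_betw_nat_finite[OF assms(1)] by (auto simp: atLeast0LessThan)
  have "f i \<in> I" if "i < card I" for i using f that by (auto simp: bij_betw_def)
  then show ?thesis
    unfolding sym_square_def sum.reindex_bij_betw[OF f, symmetric]
    by (intro CollectI exI[of _ "card I"] exI[of _ "\<alpha> \<circ> f"] exI[of _ "\<beta> \<circ> f"]) (simp add: assms)
qed

lemma sym_square_add:
  assumes "R \<in> sym_square h" "S \<in> sym_square h"
  shows "(\<lambda>X Y Z W. R X Y Z W + S X Y Z W) \<in> sym_square h"
proof -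
  from assms obtain N \<alpha> \<beta> M \<alpha>' \<beta>' where
    "\<forall>i<N::nat. \<alpha> i \<in> h \<and> \<beta> i \<in> h" "\<forall>i<M::nat. \<alpha>' i \<in> h \<and> \<beta>' i \<in> h"
    and RS: "R = (\<lambda>X Y Z W. \<Sum>i<N. \<alpha> i X Y * \<beta> i Z W + \<beta> i X Y * \<alpha> i Z W)"
      "S = (\<lambda>X Y Z W. \<Sum>i<M. \<alpha>' i X Y * \<beta>' i Z W + \<beta>' i X Y * \<alpha>' i Z W)"
    unfolding sym_square_def by blast
  then have "(\<lambda>X Y Z W. \<Sum>i\<in>{..<N} <+> {..<M}. case_sum \<alpha> \<alpha>' i X Y * case_sum \<beta> \<beta>' i Z W
      + case_sum \<beta> \<beta>' i X Y * case_sum \<alpha> \<alpha>' i Z W) \<in> sym_square h"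
    by (intro sym_square_sum) auto
  then show ?thesis by (simp add: RS sum.Plus)
qed

lemma bilinear_basis_expansion:
  fixes a :: "'a::euclidean_space \<Rightarrow> 'a \<Rightarrow> real"
  assumes "bilinear a"
  shows "(\<Sum>u\<in>Basis. \<Sum>v\<in>Basis. a u v * ((x \<bullet> u) * (y \<bullet> v))) = a x y"
proof -
  have "a x y = a (\<Sum>u\<in>Basis. (x \<bullet> u) *\<^sub>R u) (\<Sum>v\<in>Basis. (y \<bullet> v) *\<^sub>R v)"
    by (simp add: euclidean_representation)
  also have "\<dots> = (\<Sum>(u, v)\<in>Basis \<times> Basis. a ((x \<bullet> u) *\<^sub>R u) ((y \<bullet> v) *\<^sub>R v))"
    by (rule bilinear_sum[OF assms])
  finally show ?thesis
    by (simp add: sum.cartesian_product bilinear_lmul[OF assms] bilinear_rmul[OF assms] mult_ac)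
qed

text \<open>Up to the factor 8, the projection of the 2-form dual to u and v onto the forms of sp(n).\<close>

definition sp_proj :: "'n::finite E \<Rightarrow> 'n E \<Rightarrow> 'n E \<Rightarrow> 'n E \<Rightarrow> real" where
  "sp_proj u v x y =
     ((x \<bullet> u) * (y \<bullet> v) - (x \<bullet> v) * (y \<bullet> u))
     + (((\<i> *s x) \<bullet> u) * ((\<i> *s y) \<bullet> v) - ((\<i> *s x) \<bullet> v) * ((\<i> *s y) \<bullet> u))
     + ((qj x \<bullet> u) * (qj y \<bullet> v) - (qj x \<bullet> v) * (qj y \<bullet> u))
     + (((\<i> *s qj x) \<bullet> u) * ((\<i> *s qj y) \<bullet> v) - ((\<i> *s qj x) \<bullet> v) * ((\<i> *s qj y) \<bullet> u))"

lemma sp_form_sp_proj: "sp_form (sp_proj u v)"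
  unfolding sp_form_def bilinear_def
proof (intro conjI allI linearI)
  show "sp_proj u v (\<i> *s x) (\<i> *s y) = sp_proj u v x y" for x y
    by (simp add: sp_proj_def vec_i_linear algebra_simps)
  show "sp_proj u v (qj x) (qj y) = sp_proj u v x y" for x y
    by (simp add: sp_proj_def vec_i_linear algebra_simps)
qed (simp_all add: sp_proj_def vec_i_linear inner_add_left algebra_simps)

text \<open>Each L among 1, i, \<open>qj\<close>, i \<open>qj\<close> contributes a(Lx, Ly) - a(Ly,
  Lx) = 2 a(x, y), since a is skew and L-invariant; four such terms make 8.\<close>

lemma sp_proj_expansion:
  assumes "sp_form a"
  shows "(\<Sum>u\<in>Basis. \<Sum>v\<in>Basis. a u v * sp_proj u v x y) = 8 * a x y"
proof -
  note e = bilinear_basis_expansion[OF sp_form_bilinear[OF assms]]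
  have e': "(\<Sum>u\<in>Basis. \<Sum>v\<in>Basis. a u v * ((x \<bullet> v) * (y \<bullet> u))) = a y x" for x y
    by (rule trans[OF _ e]) (simp add: mult_ac)
  have "\<i> *s qj x = qj (- (\<i> *s x))" for x by (simp add: vec_i_linear)
  then have iq: "a (\<i> *s qj x) (\<i> *s qj y) = a x y" for x y
    by (simp only: sp_form_qj[OF assms] sp_form_i[OF assms])
  show ?thesis
    unfolding sp_proj_def
    by (simp only: distrib_left right_diff_distrib sum.distrib sum_subtractf e e'
        sp_form_i[OF assms] sp_form_qj[OF assms] iq) (simp add: sp_form_skew[OF assms, of y x])
qed

lemma sp_form_scaled_in_rho_forms: "sp_form a \<Longrightarrow> (\<lambda>X Y. c * a (fst X) (fst Y)) \<in> rho_forms"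
  using sp_form_in_rho_forms[OF sp_form_scale, of a c 0] by simp

lemma beta_in_rho_forms: "(\<lambda>X Y. c * beta X Y) \<in> rho_forms"
proof -
  have "sp_form (\<lambda>x y. 0 :: real)" using sp_form_scale[OF sp_form_sp_proj, of 0] by simp
  from sp_form_in_rho_forms[OF this, of c] show ?thesis by simp
qed

lemma hlift_in_sym_square:
  fixes r :: "'n::finite hor4"
  assumes r: "sp_square r"
  shows "hlift r \<in> sym_square rho_forms"
proof -
  let ?B = "Basis \<times> Basis \<times> Basis \<times> Basis"
  \<comment> \<open>Expanding r in both pairs gives 8 * 8 = 64, and the symmetrised product counts
    everything twice, hence 128.\<close>
  define \<alpha> :: "'n E \<times> 'n E \<times> 'n E \<times> 'n E \<Rightarrow> 'n T \<Rightarrow> 'n T \<Rightarrow> real"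
    where "\<alpha> = (\<lambda>(u, v, u', v') X Y. (r u v u' v' / 128) * sp_proj u v (fst X) (fst Y))"
  define \<beta> :: "'n E \<times> 'n E \<times> 'n E \<times> 'n E \<Rightarrow> 'n T \<Rightarrow> 'n T \<Rightarrow> real"
    where "\<beta> = (\<lambda>(u, v, u', v') X Y. 1 * sp_proj u' v' (fst X) (fst Y))"
  have "(\<lambda>X Y Z W. \<Sum>i\<in>?B. \<alpha> i X Y * \<beta> i Z W + \<beta> i X Y * \<alpha> i Z W) \<in> sym_square rho_forms"
  proof (rule sym_square_sum)
    show "\<alpha> i \<in> rho_forms" "\<beta> i \<in> rho_forms" for i
      by (cases i; simp only: \<alpha>_def \<beta>_def prod.case sp_form_scaled_in_rho_forms[OF sp_form_sp_proj])+
  qed simp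
  moreover have "(\<Sum>i\<in>?B. \<alpha> i X Y * \<beta> i Z W + \<beta> i X Y * \<alpha> i Z W) = hlift r X Y Z W" for X Y Z W
  proof -
    have e: "(\<Sum>u\<in>Basis. \<Sum>v\<in>Basis. \<Sum>u'\<in>Basis. \<Sum>v'\<in>Basis.
        r u v u' v' * sp_proj u v x y * sp_proj u' v' z w) = 64 * r x y z w" for x y z w
    proof -
      have "(\<Sum>u'\<in>Basis. \<Sum>v'\<in>Basis. r u v u' v' * sp_proj u v x y * sp_proj u' v' z w)
          = sp_proj u v x y * (8 * r u v z w)" for u v
        unfolding sp_proj_expansion[OF sp_square_sp_form_right[OF r], symmetric] sum_distrib_left
        by (simp add: mult_ac)
      then have "(\<Sum>u\<in>Basis. \<Sum>v\<in>Basis. \<Sum>u'\<in>Basis. \<Sum>v'\<in>Basis.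
        r u v u' v' * sp_proj u v x y * sp_proj u' v' z w) =
          8 * (\<Sum>u\<in>Basis. \<Sum>v\<in>Basis. r u v z w * sp_proj u v x y)"
        by (simp add: sum_distrib_left mult_ac)
      then show ?thesis
        unfolding sp_proj_expansion[OF sp_square_sp_form_left[OF r]] by simp
    qed
    have "128 * (\<Sum>i\<in>?B. \<alpha> i X Y * \<beta> i Z W + \<beta> i X Y * \<alpha> i Z W) =
        (\<Sum>u\<in>Basis. \<Sum>v\<in>Basis. \<Sum>u'\<in>Basis. \<Sum>v'\<in>Basis.
          r u v u' v' * sp_proj u v (fst X) (fst Y) * sp_proj u' v' (fst Z) (fst W)) +
        (\<Sum>u\<in>Basis. \<Sum>v\<in>Basis. \<Sum>u'\<in>Basis. \<Sum>v'\<in>Basis.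
          r u v u' v' * sp_proj u v (fst Z) (fst W) * sp_proj u' v' (fst X) (fst Y))"
      unfolding sum.distrib[symmetric] sum.cartesian_product sum_distrib_left
      by (rule sum.cong) (auto simp: \<alpha>_def \<beta>_def algebra_simps)
    also have "\<dots> = 128 * hlift r X Y Z W"
      unfolding e hlift_def using sp_square_swap[OF r, of "fst Z" "fst W"] by simp
    finally show ?thesis by simp
  qed
  ultimately show ?thesis by simp
qed

lemma beta_sq_in_sym_square: "(\<lambda>X Y Z (W :: 'n::finite T). c * beta X Y * beta Z W) \<in> sym_square rho_forms"
proof -
  have "(\<lambda>X Y Z (W :: 'n T). \<Sum>i\<in>{()}. (c / 2 * beta X Y) * (1 * beta Z W) + (1 * beta X Y) * (c / 2 * beta Z W))
      \<in> sym_square rho_forms"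
    by (rule sym_square_sum) (simp_all only: finite.intros beta_in_rho_forms)
  moreover have "(\<Sum>i\<in>{()}. (c / 2 * beta X Y) * (1 * beta Z W) + (1 * beta X Y) * (c / 2 * beta Z W)) =
      c * beta X Y * beta Z W" for X Y Z W :: "'n T"
    by simp
  ultimately show ?thesis by (simp only:)
qed

lemma sym_square_rho_formsE:
  assumes "R \<in> sym_square rho_forms"
  obtains S d k where "sp_square S" "sp_form d"
    "\<And>X Y Z W. R X Y Z W = hlift S X Y Z W + beta X Y * d (fst Z) (fst W) + d (fst X) (fst Y) * beta Z W
       + k * beta X Y * beta Z W"
proof -
  from assms obtain N \<alpha> \<beta> where mem: "\<And>i. i < N \<Longrightarrow> \<alpha> i \<in> rho_forms" "\<And>i. i < N \<Longrightarrow> \<beta> i \<in> rho_forms"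
    and R: "R = (\<lambda>X Y Z W. \<Sum>i<N::nat. \<alpha> i X Y * \<beta> i Z W + \<beta> i X Y * \<alpha> i Z W)"
    unfolding sym_square_def by blast
  have "\<exists>a s. sp_form a \<and> (\<forall>X Y. \<alpha> i X Y = a (fst X) (fst Y) + s * beta X Y)" if "i < N" for i
    using mem(1)[OF that] unfolding rho_forms_eq by auto
  then obtain a s where a: "\<And>i. i < N \<Longrightarrow> sp_form (a i)"
    and \<alpha>: "\<And>i X Y. i < N \<Longrightarrow> \<alpha> i X Y = a i (fst X) (fst Y) + s i * beta X Y"
    by metis
  have "\<exists>a s. sp_form a \<and> (\<forall>X Y. \<beta> i X Y = a (fst X) (fst Y) + s * beta X Y)" if "i < N" for i
    using mem(2)[OF that] unfolding rho_forms_eq by auto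
  then obtain b t where b: "\<And>i. i < N \<Longrightarrow> sp_form (b i)"
    and \<beta>: "\<And>i X Y. i < N \<Longrightarrow> \<beta> i X Y = b i (fst X) (fst Y) + t i * beta X Y"
    by metis
  define S where "S x y z w = (\<Sum>i<N. a i x y * b i z w) + (\<Sum>i<N. b i x y * a i z w)" for x y z w
  define d where "d x y = (\<Sum>i<N. a i x y * t i) + (\<Sum>i<N. b i x y * s i)" for x y
  show thesis
  proof
    show "sp_square S"
      unfolding sp_square_def S_def
    proof (intro conjI allI)
      show "sp_form (\<lambda>x y. (\<Sum>i<N. a i x y * b i z w) + (\<Sum>i<N. b i x y * a i z w))" for z w
        by (intro sp_form_add sp_form_sum a b) auto
    qed (simp add: mult.commute add.commute)
    show "sp_form d"
      unfolding d_def by (auto intro!: sp_form_add sp_form_sum a b)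
    show "R X Y Z W = hlift S X Y Z W + beta X Y * d (fst Z) (fst W) + d (fst X) (fst Y) * beta Z W
       + (\<Sum>i<N. 2 * s i * t i) * beta X Y * beta Z W" for X Y Z W
      unfolding R hlift_def S_def d_def distrib_left distrib_right sum_distrib_left sum_distrib_right
        sum.distrib[symmetric]
      by (rule sum.cong) (simp_all add: \<alpha> \<beta> algebra_simps)
  qed
qed

section \<open>Torsion and the Bianchi map\<close>

text \<open>Twice \<open>omega0\<close> on H: the complex symplectic form without the normalisation
  of the dual basis.\<close>

definition omega :: "'n::finite E \<Rightarrow> 'n E \<Rightarrow> complex" where
  "omega x y = Complex (qj x \<bullet> y) ((\<i> *s qj x) \<bullet> y)"

lemma inner_qj_swap: "qj x \<bullet> y = - (qj y \<bullet> x)"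
  by (metis inner_qj_left inner_commute)

lemma inner_i_swap: "(\<i> *s x) \<bullet> y = - ((\<i> *s y) \<bullet> (x :: complex ^ 'm))"
  by (metis inner_i_left inner_commute)

lemma inner_i_qj_swap: "(\<i> *s qj x) \<bullet> y = - ((\<i> *s qj y) \<bullet> x)"
  by (simp add: inner_qj_left inner_i_left inner_commute[of x] vec_i_linear)

lemma omega_swap: "omega y x = - omega x y"
  by (simp add: omega_def complex_eq_iff inner_qj_swap[of y x] inner_i_qj_swap[of y x])

text \<open>The term with the vertical part of W gives the vertical component of T(X, Y); the other
  two, rewritten through \<open>qj\<close>, give the horizontal one. Adding the conjugate cancels
  the 1/2 in \<open>omega0\<close>, and 1/sqrt 2 is left from \<open>dual_ver\<close>.\<close>

lemma inner_riesz_torsion: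
  "((1 / sqrt 2) *\<^sub>R (qj (z *s (cnj (snd X) *s fst Y - cnj (snd Y) *s fst X)),
      z * omega (fst X) (fst Y))) \<bullet> W = torsion z X Y W"
proof -
  have q: "qj (c *s y) \<bullet> w = Re (c * omega y w)" for c and y w :: "'a E"
    by (simp add: omega_def vec_complex_split[of "cnj c"] inner_add_left inner_diff_left)
  have "torsion z X Y W = (1 / sqrt 2) * Re (z * (omega (fst X) (fst Y) * cnj (snd W)
      + omega (fst Y) (fst W) * cnj (snd X) - omega (fst X) (fst W) * cnj (snd Y)))"
    unfolding torsion_def T0_def wedge21_def omega0_eq omega_def[symmetric] dual_ver_def
      omega_swap[of "fst W" "fst X"]
    by (simp add: add_divide_distrib diff_divide_distrib algebra_simps)
  also have "\<dots> = ((1 / sqrt 2) *\<^sub>R (qj (z *s (cnj (snd X) *s fst Y - cnj (snd Y) *s fst X)),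
      z * omega (fst X) (fst Y))) \<bullet> W"
    unfolding inner_prod_def vec.scale_right_diff_distrib vec.scale_scale
    by (simp add: inner_diff_left q inner_complex_def algebra_simps del: qj_linear(6))
  finally show ?thesis by simp
qed

lemma riesz_torsion:
  "riesz (torsion z X Y) =
    (1 / sqrt 2) *\<^sub>R (qj (z *s (cnj (snd X) *s fst Y - cnj (snd Y) *s fst X)), z * omega (fst X) (fst Y))"
  by (rule riesz_eqI) (rule inner_riesz_torsion)

text \<open>Twice the inner product of the values of the torsion with parameter 1.\<close>

definition tau :: "'n::finite tensor4" where
  "tau X Y Z W =
     (cnj (snd X) *s fst Y - cnj (snd Y) *s fst X) \<bullet> (cnj (snd Z) *s fst W - cnj (snd W) *s fst Z)
     + omega (fst X) (fst Y) \<bullet> omega (fst Z) (fst W)"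

lemma inner_complex_mult: "(z * a) \<bullet> (z * b) = (cmod z)\<^sup>2 * (a \<bullet> b)" for z a b :: complex
  unfolding inner_complex_def cmod_power2 by (simp add: power2_eq_square algebra_simps)

lemma inner_vec_mult: "(z *s x) \<bullet> (z *s y) = (cmod z)\<^sup>2 * (x \<bullet> (y :: complex ^ 'm))"
  by (simp add: inner_vec_def inner_complex_mult sum_distrib_left)

lemma riesz_torsion_inner:
  "riesz (torsion z X Y) \<bullet> riesz (torsion z Z W) = (cmod z)\<^sup>2 / 2 * tau X Y Z W"
  unfolding riesz_torsion tau_def
  by (simp only: inner_scaleR_left inner_scaleR_right inner_Pair inner_qj_qj inner_vec_mult inner_complex_mult)
    (simp add: field_simps)

text \<open>Up to the isometry \<open>qj\<close>, both components of T(X, Y) are multiplied by z, so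
  only |z| matters. Hence the line spanned by sigma for parameter 1 contains sigma for every
  z.\<close>

lemma sigma_form_torsion:
  "sigma_form (torsion z) X Y Z W = (cmod z)\<^sup>2 * sigma_form (torsion 1) X Y Z W"
  unfolding sigma_form_def riesz_torsion_inner by (simp add: algebra_simps)

text \<open>The bracket with coefficients 1, 2, 2, 4 factors as \<open>beta X Y * beta Z W\<close>,
  and the sum over 1, I, J, K is the unnormalised projection to sp(n). This exhibits R0 as an
  element of S^2(sp(n) + u(1)).\<close>

lemma R0_eq:
  "R0 X Y Z W = sp_proj (fst W) (fst Z) (fst X) (fst Y) - 2 * beta X Y * beta Z W"
  by (simp add: R0_def sp_proj_def endI_eq endK_eq endJ_def beta_eq g_hor_def g_ver_def algebra_simps)

lemma bianchi_R0: "bianchi R0 X Y Z W = 4 * sigma_form (torsion 1) X Y Z W"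
proof -
  obtain x a y b z c w d where eq: "X = (x, a)" "Y = (y, b)" "Z = (z, c)" "W = (w, d)"
    by (metis surj_pair)
  have ic: "(\<i> * v) \<bullet> u = - ((\<i> * u) \<bullet> v)" for u v :: complex
    by (simp add: inner_complex_def)
  \<comment> \<open>Pluecker relation for the area form of the real plane V; it makes the purely
    vertical part of the cyclic sum vanish.\<close>
  have pl: "((\<i> * a) \<bullet> c) * ((\<i> * b) \<bullet> d) = ((\<i> * a) \<bullet> b) * ((\<i> * c) \<bullet> d) + ((\<i> * a) \<bullet> d) * ((\<i> * b) \<bullet> c)"
    by (simp add: inner_complex_def algebra_simps)
  \<comment> \<open>All pairings are brought to one orientation; up to \<open>pl\<close>, a
    polynomial identity remains.\<close>
  note sym = inner_qj_swap[of y x] inner_qj_swap[of z x] inner_qj_swap[of z y]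
    inner_i_swap[of y x] inner_i_swap[of z x] inner_i_swap[of z y]
    inner_i_qj_swap[of y x] inner_i_qj_swap[of z x] inner_i_qj_swap[of z y] ic[of b a] ic[of c a] ic[of c b]
    inner_commute[of y x] inner_commute[of z x] inner_commute[of z y]
    inner_commute[of b a] inner_commute[of c a] inner_commute[of c b]
  show ?thesis
    unfolding bianchi_def R0_eq sigma_form_def riesz_torsion_inner tau_def sp_proj_def beta_eq eq fst_conv snd_conv
      inner_diff_left inner_diff_right inner_scale_scale omega_def inner_complex_def[of "Complex _ _"] complex.sel
      sym
    using pl by (simp add: algebra_simps)
qed

lemma sp_square_sp_proj: "sp_square (\<lambda>x y z w. sp_proj w z x y)"
  unfolding sp_square_def
proof (intro conjI allI)
  fix x y z w :: "'a E"
  have *: "\<i> *s qj u = - qj (\<i> *s u)" for u :: "'a E" by (simp add: vec_i_linear)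
  show "sp_proj w z x y = sp_proj y x z w"
    unfolding sp_proj_def * 
    by (simp add: inner_qj_left inner_i_left inner_commute[of _ w] inner_commute[of _ z] vec_i_linear algebra_simps)
qed (rule sp_form_sp_proj)

text \<open>Only the \<open>beta\<close> term survives here, and tensors lifted from H vanish, so
  this component reads off the coefficient of R0.\<close>

lemma R0_mixed: "R0 (x, 0) (\<i> *s x, 0) (0, 1) (0, \<i>) = - 4 * (x \<bullet> x)"
  by (simp add: R0_eq sp_proj_def beta_eq inner_i_i inner_complex_def vec_i_linear)

text \<open>Together with \<open>bianchi_R0\<close> this shows that sigma is not zero.\<close>

lemma bianchi_R0_mixed:
  "bianchi R0 (x, 0) (\<i> *s x, 0) (0, 1) (0, \<i>) = - 4 * (x \<bullet> x)"
  unfolding bianchi_def R0_mixed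
  by (simp add: R0_eq sp_proj_def beta_eq inner_i_i inner_complex_def vec_i_linear)

section \<open>Splitting of the space of curvature tensors\<close>

lemma ex_nonzero_vec: obtains x :: "'n::finite E" where "x \<bullet> x \<noteq> 0"
  using nonempty_Basis nonzero_Basis by (metis ex_in_conv inner_eq_zero_iff)

definition curv_of :: "real \<Rightarrow> 'n::finite hor4 \<Rightarrow> 'n tensor4" where
  "curv_of c r X Y Z W = c * R0 X Y Z W + hlift r X Y Z W"

lemma bianchi_hlift: "hk r \<Longrightarrow> bianchi (hlift r) X Y Z W = 0"
  unfolding hk_def bianchi_def hlift_def by blast

lemma bianchi_curv_of:
  assumes "hk r"
  shows "bianchi (curv_of c r) X Y Z W = 4 * c * sigma_form (torsion 1) X Y Z W"
proof -
  have "bianchi (curv_of c r) X Y Z W = c * bianchi R0 X Y Z W + bianchi (hlift r) X Y Z W"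
    by (simp add: bianchi_def curv_of_def algebra_simps)
  then show ?thesis by (simp add: bianchi_R0 bianchi_hlift[OF assms])
qed

lemma curv_of_inj:
  assumes "hk r" "hk r'" "curv_of c r = curv_of c' (r' :: 'n::finite hor4)"
  shows "c = c'" "r = r'"
proof -
  obtain x :: "'n E" where x: "x \<bullet> x \<noteq> 0" by (rule ex_nonzero_vec)
  have z: "r x y 0 0 = 0" "r' x y 0 0 = 0" for x y
    using assms sp_form_zero[OF sp_square_sp_form_right] by (metis hk_def)+
  have "curv_of c r (x, 0) (\<i> *s x, 0) (0, 1) (0, \<i>) = curv_of c' r' (x, 0) (\<i> *s x, 0) (0, 1) (0, \<i>)"
    by (simp only: assms)
  then show c: "c = c'"
    unfolding curv_of_def R0_mixed hlift_def using x by (simp add: z)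
  have "r x y z w = r' x y z w" for x y z w
  proof -
    have "curv_of c r (x, 0) (y, 0) (z, 0) (w, 0) = curv_of c' r' (x, 0) (y, 0) (z, 0) (w, 0)"
      by (simp only: assms)
    then show ?thesis by (simp add: curv_of_def c hlift_def)
  qed
  then show "r = r'" by (intro ext)
qed

lemma curv_space_eq: "curv_space = {curv_of c r | c r. hk (r :: 'n::finite hor4)}"
proof (intro equalityI subsetI)
  fix R :: "'n tensor4"
  assume "R \<in> {curv_of c r | c r. hk r}"
  then obtain c r where r: "hk r" and R: "R = curv_of c r" by blast
  have "sp_square (\<lambda>x y z w. c * sp_proj w z x y + r x y z w)"
    using r by (intro sp_square_add sp_square_scale sp_square_sp_proj) (simp add: hk_def)
  from sym_square_add[OF hlift_in_sym_square[OF this] beta_sq_in_sym_square[of "- 2 * c"]]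
  have "R \<in> sym_square rho_forms"
    by (simp add: R curv_of_def[abs_def] R0_eq hlift_def algebra_simps)
  moreover have "bianchi R = (\<lambda>X Y Z W. (4 * c) * sigma_form (torsion 1) X Y Z W)"
    by (simp add: R fun_eq_iff bianchi_curv_of[OF r])
  ultimately show "R \<in> curv_space" unfolding curv_space_def by blast
next
  fix R :: "'n tensor4"
  assume "R \<in> curv_space"
  then obtain c where Rs: "R \<in> sym_square rho_forms"
    and b: "bianchi R = (\<lambda>X Y Z W. c * sigma_form (torsion 1) X Y Z W)"
    unfolding curv_space_def by blast
  from sym_square_rho_formsE[OF Rs] obtain S d k where S: "sp_square S" and d: "sp_form d"
    and R: "\<And>X Y Z W. R X Y Z W = hlift S X Y Z W + beta X Y * d (fst Z) (fst W) + d (fst X) (fst Y) * beta Z W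
       + k * beta X Y * beta Z W" by blast
  \<comment> \<open>Subtracting (c/4) R0 makes the Bianchi sum zero, since b R0 = 4 sigma. The sp(n)
    part of R0 is absorbed in r, its -2 \<open>beta\<close>^2 in k' = k + c/2.\<close>
  define r where "r x y z w = S x y z w + (- (c / 4)) * sp_proj w z x y" for x y z w
  define k' where "k' = k + c / 2"
  have r: "sp_square r"
    unfolding r_def by (intro sp_square_add sp_square_scale sp_square_sp_proj S)
  have R': "R X Y Z W - c / 4 * R0 X Y Z W = hlift r X Y Z W + beta X Y * d (fst Z) (fst W)
      + d (fst X) (fst Y) * beta Z W + k' * beta X Y * beta Z W" for X Y Z W
    by (simp add: R R0_eq hlift_def r_def k'_def algebra_simps)
  have "bianchi (\<lambda>X Y Z W. R X Y Z W - c / 4 * R0 X Y Z W) X Y Z W = 0" for X Y Z W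
  proof -
    have "bianchi R X Y Z W - c / 4 * bianchi R0 X Y Z W = 0"
      unfolding b bianchi_R0 by simp
    then show ?thesis by (simp add: bianchi_def algebra_simps)
  qed
  note b' = this[unfolded R', unfolded bianchi_def]
  have z: "r x 0 y 0 = 0" "r x y 0 0 = 0" "r 0 x y 0 = 0" for x y
    using sp_form_zero[OF sp_square_sp_form_right[OF r]] by metis+
  \<comment> \<open>Here \<open>beta (0, 1) (0, \<i>)\<close> = 2 and the two cyclically permuted
    terms vanish, so the Bianchi identity is twice the claim.\<close>
  have dk: "d x y + k' * ((\<i> *s x) \<bullet> y) = 0" for x y
    using b'[of "(x, 0)" "(y, 0)" "(0, 1)" "(0, \<i>)"]
    by (simp add: hlift_def z beta_eq sp_form_zero[OF d] vec_i_linear)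
  have d0: "d x y = 0" "k' * ((\<i> *s x) \<bullet> y) = 0" for x y
  proof -
    have "\<i> *s qj x = - qj (\<i> *s x)" by (simp add: vec_i_linear)
    then have "(\<i> *s qj x) \<bullet> qj y = - ((\<i> *s x) \<bullet> y)"
      using inner_qj_qj[of "\<i> *s x" y] by simp
    then show "d x y = 0" "k' * ((\<i> *s x) \<bullet> y) = 0"
      using dk[of x y] dk[of "qj x" "qj y"] sp_form_qj[OF d, of x y] by simp_all
  qed
  obtain x :: "'n E" where x: "x \<bullet> x \<noteq> 0" by (rule ex_nonzero_vec)
  have k0: "k' = 0" using d0(2)[of x "\<i> *s x"] x by (simp add: inner_i_i)
  have "hk r"
    using r b'[of "(x, 0)" "(y, 0)" "(z, 0)" "(w, 0)" for x y z w]
    by (simp add: hk_def hlift_def d0 k0)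
  moreover have "R = curv_of (c / 4) r"
    using R' by (simp add: curv_of_def fun_eq_iff d0 k0 algebra_simps)
  ultimately show "R \<in> {curv_of c r | c r. hk r}" by blast
qed

section \<open>Norm of the torsion and Ricci tensors\<close>

lemma riesz_torsion_dot: "riesz (torsion z X Y) \<bullet> W = torsion z X Y W"
  unfolding riesz_torsion by (rule inner_riesz_torsion)

lemma sum_Basis_sq: "(\<Sum>w\<in>Basis. (v \<bullet> w) * (u \<bullet> w)) = v \<bullet> (u :: 'a::euclidean_space)"
  by (rule euclidean_inner[symmetric])

lemma sum_Basis_prod:
  fixes f :: "'a::euclidean_space \<times> 'b::euclidean_space \<Rightarrow> real"
  shows "(\<Sum>u\<in>Basis. f u) = (\<Sum>x\<in>Basis. f (x, 0)) + (\<Sum>y\<in>Basis. f (0, y))"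
proof -
  have "inj_on (\<lambda>x :: 'a. (x, 0 :: 'b)) Basis" "inj_on (\<lambda>y :: 'b. (0 :: 'a, y)) Basis"
    by (simp_all add: inj_on_def)
  moreover have "(\<lambda>x :: 'a. (x, 0 :: 'b)) ` Basis \<inter> (\<lambda>y. (0, y)) ` Basis = {}"
    using nonzero_Basis by fastforce
  ultimately show ?thesis
    unfolding Basis_prod_def by (simp add: sum.union_disjoint sum.reindex)
qed

lemma sum_tau_hor: "(\<Sum>y\<in>Basis. tau (x, 0) (y, 0) (x, 0) (y, 0)) = 2 * (x \<bullet> x)"
proof -
  have "tau (x, 0) (y, 0) (x, 0) (y, 0) = (qj x \<bullet> y) * (qj x \<bullet> y) + ((\<i> *s qj x) \<bullet> y) * ((\<i> *s qj x) \<bullet> y)" for y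
    by (simp add: tau_def omega_def inner_complex_def[of "Complex _ _"])
  then show ?thesis
    by (simp only: sum.distrib sum_Basis_sq inner_i_i inner_qj_qj)
qed

lemma tau_mixed: "tau (x, 0) (0, d) (x, 0) (0, d) = (d \<bullet> d) * (x \<bullet> x)"
  "tau (0, d) (x, 0) (0, d) (x, 0) = (d \<bullet> d) * (x \<bullet> x)"
  "tau (0, c) (0, d) (0, c) (0, d) = 0"
proof -
  have "(cnj d *s x) \<bullet> (cnj d *s x) = (d \<bullet> d) * (x \<bullet> x)"
    by (simp only: inner_vec_mult complex_mod_cnj power2_norm_eq_inner)
  then show "tau (x, 0) (0, d) (x, 0) (0, d) = (d \<bullet> d) * (x \<bullet> x)"
    "tau (0, d) (x, 0) (0, d) (x, 0) = (d \<bullet> d) * (x \<bullet> x)"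
    by (simp_all add: tau_def omega_def inner_complex_def[of "Complex _ _"] vec_i_linear)
  show "tau (0, c) (0, d) (0, c) (0, d) = 0"
    by (simp add: tau_def omega_def inner_complex_def[of "Complex _ _"] vec_i_linear)
qed

text \<open>The 4n horizontal basis vectors contribute 2 each, that is 8n; each of the two mixed
  blocks has 4n * 2 entries equal to 1; the vertical block is 0.\<close>

lemma sum_tau: "(\<Sum>u\<in>Basis. \<Sum>v\<in>Basis. tau u v u (v :: 'n::finite T)) = 24 * real CARD('n)"
  unfolding sum_Basis_prod sum.distrib sum_tau_hor tau_mixed
  by (simp add: inner_Basis)

lemma norm3_sq_torsion:
  "norm3_sq (torsion z :: 'n::finite tensor3) = 12 * real CARD('n) * (cmod z)\<^sup>2"
proof -
  have "(\<Sum>w\<in>Basis. (torsion z u v w)\<^sup>2) = (cmod z)\<^sup>2 / 2 * tau u v u v" for u v :: "'n T"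
  proof -
    have "(torsion z u v w)\<^sup>2 = (riesz (torsion z u v) \<bullet> w) * (riesz (torsion z u v) \<bullet> w)" for w
      by (simp only: riesz_torsion_dot power2_eq_square)
    then have "(\<Sum>w\<in>Basis. (torsion z u v w)\<^sup>2) = riesz (torsion z u v) \<bullet> riesz (torsion z u v)"
      by (simp only: sum_Basis_sq)
    then show ?thesis by (simp only: riesz_torsion_inner)
  qed
  then have "norm3_sq (torsion z :: 'n tensor3) = (cmod z)\<^sup>2 / 2 * (\<Sum>u\<in>Basis. \<Sum>v\<in>Basis. tau u v u (v :: 'n T))"
    unfolding norm3_sq_def sum_distrib_left by (intro sum.cong refl)
  then show ?thesis by (simp add: sum_tau)
qed

text \<open>The images p u form another orthonormal basis. Skewness moves p onto v and w after
  expanding f, so no change of basis is carried out.\<close>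

lemma trace_invariant:
  fixes f :: "'a::euclidean_space \<Rightarrow> 'a \<Rightarrow> real"
  assumes f: "bilinear f" and skew: "\<And>x y. p x \<bullet> y = - (x \<bullet> p y)" and iso: "\<And>x y. p x \<bullet> p y = x \<bullet> y"
  shows "(\<Sum>u\<in>Basis. f (p u) (p u)) = (\<Sum>u\<in>Basis. f u u)"
proof -
  have pv: "p u \<bullet> v = - (p v \<bullet> u)" for u v by (metis skew inner_commute)
  have pp: "(p u \<bullet> v) * (p u \<bullet> w) = (p v \<bullet> u) * (p w \<bullet> u)" for u v w
    by (simp add: pv[of u v] pv[of u w])
  have "(\<Sum>u\<in>Basis. f (p u) (p u)) = (\<Sum>u\<in>Basis. \<Sum>v\<in>Basis. \<Sum>w\<in>Basis. f v w * ((p u \<bullet> v) * (p u \<bullet> w)))"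
    by (simp add: bilinear_basis_expansion[OF f])
  also have "\<dots> = (\<Sum>v\<in>Basis. \<Sum>w\<in>Basis. \<Sum>u\<in>Basis. f v w * ((p u \<bullet> v) * (p u \<bullet> w)))"
    by (subst sum.swap, rule sum.cong[OF refl], rule sum.swap)
  also have "\<dots> = (\<Sum>v\<in>Basis. \<Sum>w\<in>Basis. f v w * (\<Sum>u\<in>Basis. (p v \<bullet> u) * (p w \<bullet> u)))"
    by (simp only: pp sum_distrib_left)
  also have "\<dots> = (\<Sum>v\<in>Basis. \<Sum>w\<in>Basis. if v = w then f v w else 0)"
    unfolding sum_Basis_sq iso by (intro sum.cong refl) (simp add: inner_Basis)
  finally show ?thesis by simp
qed

section \<open>Ricci and scalar curvature\<close>

lemma hk_sp_square: "hk r \<Longrightarrow> sp_square r"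
  by (simp add: hk_def)

lemma hk_bianchi: "hk r \<Longrightarrow> r x y z w + r y z x w + r z x y w = 0"
  unfolding hk_def by blast

lemma Ric_hlift:
  fixes r :: "'n::finite hor4"
  assumes r: "hk r"
  shows "Ric (hlift r) Y Z = 0"
proof -
  note s = hk_sp_square[OF r]
  note s1 = sp_square_sp_form_left[OF s] and s2 = sp_square_sp_form_right[OF s]
  note bil1 = sp_form_bilinear[OF s1] and bil2 = sp_form_bilinear[OF s2]
  define q where "q y z = (\<Sum>u\<in>Basis. r u y z u)" for y z
  have neg: "q (- y) z = - q y z" "q y (- z) = - q y z" for y z
    using bilinear_rneg[OF bil1] bilinear_lneg[OF bil2] by (simp_all add: q_def sum_negf)
  have sym: "q y z = q z y" for y z
    unfolding q_def
  proof (rule sum.cong[OF refl])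
    fix u
    show "r u y z u = r u z y u"
      using sp_form_skew[OF s1, of z u u y] sp_form_skew[OF s2, of u z u y] sp_square_swap[OF s, of u y z u]
      by linarith
  qed
  have bil: "bilinear (\<lambda>u u'. r u y z u')" for y z
    using bil1 bil2 by (auto simp: bilinear_def)
  have ii: "q (\<i> *s y) (\<i> *s z) = q y z" for y z
    using trace_invariant[OF bil[of "\<i> *s y" "\<i> *s z"], of "\<lambda>u. \<i> *s u"]
    by (simp add: q_def inner_i_left sp_form_i[OF s1] sp_form_i[OF s2])
  \<comment> \<open>The Ricci form vanishes because qj commutes with the curvature and anticommutes with i.\<close>
  have tr: "(\<Sum>u\<in>Basis. r x y u (\<i> *s u)) = 0" for x y
  proof -
    have b: "bilinear (\<lambda>u u'. r x y u (\<i> *s u'))"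
      using bil2[of x y] linear_compose[OF linear_vec_i] by (force simp: bilinear_def o_def)
    have "r x y (qj u) (\<i> *s qj u) = - r x y u (\<i> *s u)" for u
    proof -
      have "\<i> *s qj u = - qj (\<i> *s u)" by (simp add: vec_i_linear)
      then show ?thesis by (simp only: bilinear_rneg[OF bil2] sp_form_qj[OF s2])
    qed
    then show ?thesis
      using trace_invariant[OF b, of qj] by (simp add: inner_qj_left inner_qj_qj sum_negf)
  qed
  \<comment> \<open>The Bianchi identity with fourth argument i u, summed over u: the first term is
    the vanishing trace, and the other two give the symmetry of q(., i .).\<close>
  have sw: "q y (\<i> *s x) = q x (\<i> *s y)" for x y
  proof -
    have "r x y u (\<i> *s u) + r u y (\<i> *s x) u - r u x (\<i> *s y) u = 0" for u
      using hk_bianchi[OF r, of x y u "\<i> *s u"] sp_form_skew[OF s1, of y u x "\<i> *s u"]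
        sp_form_i_left[OF s2, of u y x u] sp_form_i_left[OF s2, of u x y u] by linarith
    then have "(\<Sum>u\<in>Basis. r x y u (\<i> *s u) + r u y (\<i> *s x) u - r u x (\<i> *s y) u) = 0"
      by simp
    then show ?thesis by (simp add: sum.distrib sum_subtractf tr q_def)
  qed
  \<comment> \<open>By \<open>ii\<close> and \<open>sym\<close> the form q(., i .) is skew, whereas
    \<open>sw\<close> makes it symmetric.\<close>
  have "q y (\<i> *s x) = 0" for x y
  proof -
    have "q x (\<i> *s y) = q (\<i> *s (\<i> *s y)) (\<i> *s x)" unfolding ii by (rule sym)
    also have "\<dots> = - q y (\<i> *s x)" by (simp add: neg)
    finally show ?thesis using sw[of y x] by simp
  qed
  from this[of _ "- (\<i> *s z)" for z] have "q y z = 0" for y z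
    by (simp add: vec_i_linear)
  then show ?thesis
    unfolding Ric_def sum_Basis_prod hlift_def fst_conv q_def[symmetric]
    by (simp add: sp_form_zero[OF s1])
qed

text \<open>On H, the term L = 1 gives 4n - 1, each of I, J, K gives 1, and the \<open>beta\<close>
  term gives 2, in total 4n + 4. On V only the \<open>beta\<close> term contributes, namely 2 * 4 =
  8.\<close>

lemma Ric_R0:
  fixes Y Z :: "'n::finite T"
  shows "Ric R0 Y Z = 4 * ((real CARD('n) + 1) * g_hor Y Z + 2 * g_ver Y Z)"
proof -
  obtain y b z c where eq: "Y = (y, b)" "Z = (z, c)" by (metis surj_pair)
  have iself: "(\<i> *s u) \<bullet> u = 0" "qj u \<bullet> u = 0" "(\<i> *s qj u) \<bullet> u = 0" for u :: "'n E"
    using inner_i_swap[of u u] inner_qj_swap[of u u] inner_i_qj_swap[of u u] by simp_all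
  have zl: "z \<bullet> (\<i> *s u) = - ((\<i> *s z) \<bullet> u)" "z \<bullet> qj u = - (qj z \<bullet> u)"
    "z \<bullet> (\<i> *s qj u) = - ((\<i> *s qj z) \<bullet> u)" for u
    using inner_i_left[of z u] inner_qj_left[of z u] inner_i_qj_swap[of u z]
    by (simp_all only: minus_minus inner_commute[of z])
  have zl': "(\<i> *s z) \<bullet> qj u = (\<i> *s qj z) \<bullet> u" for u
    using inner_qj_left[of "\<i> *s z" u] by (simp add: vec_i_linear)
  have "(\<Sum>u\<in>Basis. sp_proj u z u y) = (\<Sum>u\<in>Basis. (u \<bullet> u) * (y \<bullet> z) - (z \<bullet> u) * (y \<bullet> u)
      + ((\<i> *s z) \<bullet> u) * ((\<i> *s y) \<bullet> u) + (qj z \<bullet> u) * (qj y \<bullet> u) + ((\<i> *s qj z) \<bullet> u) * ((\<i> *s qj y) \<bullet> u))"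
    by (rule sum.cong[OF refl])
      (simp add: sp_proj_def iself zl zl' inner_commute[of _ z])
  also have "\<dots> = (4 * real CARD('n) + 2) * (y \<bullet> z)"
    unfolding sum.distrib sum_subtractf sum_Basis_sq inner_i_i inner_qj_qj
    by (simp add: inner_commute[of z y] inner_Basis algebra_simps)
  finally have 1: "(\<Sum>u\<in>Basis. sp_proj u z u y) = (4 * real CARD('n) + 2) * (y \<bullet> z)" .
  have "(\<Sum>u\<in>Basis. beta (u, 0) (y, b) * beta (z, c) (u, 0)) = - (y \<bullet> z)"
  proof -
    have "(\<Sum>u\<in>Basis. beta (u, 0) (y, b) * beta (z, c) (u, 0))
        = - (\<Sum>u\<in>Basis. ((\<i> *s y) \<bullet> u) * ((\<i> *s z) \<bullet> u))"
      unfolding sum_negf[symmetric]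
      by (rule sum.cong[OF refl]) (simp add: beta_eq inner_i_swap[of _ y])
    then show ?thesis by (simp only: sum_Basis_sq inner_i_i)
  qed
  moreover have "(\<Sum>v\<in>Basis. beta (0, v) (y, b) * beta (z, c) (0, v)) = - 4 * (b \<bullet> c)"
    by (simp add: beta_eq vec_i_linear Basis_complex_def inner_complex_def)
  moreover have "sp_proj 0 z 0 y = 0"
    by (simp add: sp_proj_def vec_i_linear)
  ultimately show ?thesis
    unfolding Ric_def sum_Basis_prod R0_eq eq fst_conv sum_subtractf g_hor_def g_ver_def snd_conv
      1 mult.assoc sum_distrib_left[symmetric]
    by (simp add: algebra_simps)
qed

lemma Ric_curv_of:
  fixes r :: "'n::finite hor4"
  assumes "hk r"
  shows "Ric (curv_of c r) Y Z = 4 * c * ((real CARD('n) + 1) * g_hor Y Z + 2 * g_ver Y Z)"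
proof -
  have "Ric (curv_of c r) Y Z = c * Ric R0 Y Z + Ric (hlift r) Y Z"
    by (simp add: Ric_def curv_of_def sum.distrib sum_distrib_left)
  then show ?thesis by (simp add: Ric_R0 Ric_hlift[OF assms])
qed

lemma scal_curv_of:
  fixes r :: "'n::finite hor4"
  assumes "hk r"
  shows "scal (curv_of c r) = 16 * c * ((real CARD('n))\<^sup>2 + real CARD('n) + 1)"
proof -
  have "(\<Sum>u\<in>Basis. g_hor u (u :: 'n T)) = 4 * real CARD('n)" "(\<Sum>u\<in>Basis. g_ver u (u :: 'n T)) = 2"
    by (simp_all add: sum_Basis_prod g_hor_def g_ver_def)
  moreover have "scal (curv_of c r) = 4 * c * ((real CARD('n) + 1) * (\<Sum>u\<in>Basis. g_hor u (u :: 'n T))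
      + 2 * (\<Sum>u\<in>Basis. g_ver u (u :: 'n T)))"
    unfolding scal_def Ric_curv_of[OF assms] sum_distrib_left[symmetric] sum.distrib ..
  ultimately show ?thesis by (simp add: power2_eq_square algebra_simps)
qed

lemma hyperkaehler_hlift:
  fixes r :: "'n::finite hor4"
  assumes r: "hk r"
  shows "hyperkaehler_tensor (hlift r)"
proof -
  note s = hk_sp_square[OF r]
  note s1 = sp_square_sp_form_left[OF s] and s2 = sp_square_sp_form_right[OF s]
  note bil1 = sp_form_bilinear[OF s1] and bil2 = sp_form_bilinear[OF s2]
  have lin: "linear (\<lambda>X. hlift r X Y Z W)" "linear (\<lambda>X. hlift r Y X Z W)"
    "linear (\<lambda>X. hlift r Y Z X W)" "linear (\<lambda>X. hlift r Y Z W X)" for Y Z W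
    by (rule linearI; simp add: hlift_def bilinear_ladd[OF bil1] bilinear_radd[OF bil1] bilinear_ladd[OF bil2]
        bilinear_radd[OF bil2] bilinear_lmul[OF bil1] bilinear_rmul[OF bil1] bilinear_lmul[OF bil2]
        bilinear_rmul[OF bil2])+
  have alg: "algebraic_curvature_tensor (hlift r)"
    unfolding algebraic_curvature_tensor_def
  proof (intro conjI allI)
    show "hlift r X Y Z W = - hlift r Y X Z W" for X Y Z W
      unfolding hlift_def by (rule sp_form_skew[OF s1])
    show "hlift r X Y Z W = - hlift r X Y W Z" for X Y Z W
      unfolding hlift_def by (rule sp_form_skew[OF s2])
    show "hlift r X Y Z W = hlift r Z W X Y" for X Y Z W
      unfolding hlift_def by (rule sp_square_swap[OF s])
  qed (rule lin bianchi_hlift[OF r])+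
  have op: "curv_op (hlift r) X Y Z \<bullet> W = hlift r X Y Z W" for X Y Z W
    unfolding curv_op_def by (rule riesz_inner) (rule lin)
  have com: "curv_op (hlift r) X Y \<circ> L = L \<circ> curv_op (hlift r) X Y"
    if L: "\<And>Z W. L Z \<bullet> W = - (Z \<bullet> L W)" and rL: "\<And>Z W. hlift r X Y (L Z) W = - hlift r X Y Z (L W)"
    for L :: "'n T \<Rightarrow> 'n T" and X Y
    by (rule ext, subst vector_eq_rdot[symmetric]) (simp add: op L rL)
  have iq: "(\<i> *s qj u) \<bullet> z = - (u \<bullet> (\<i> *s qj z))" for u z :: "'n E"
    by (metis inner_i_qj_swap inner_commute)
  have riq: "r x y (\<i> *s qj z) w = - r x y z (\<i> *s qj w)" for x y z w
  proof -
    have "\<i> *s qj w = - qj (\<i> *s w)" by (simp add: vec_i_linear)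
    then show ?thesis
      by (simp only: sp_form_i_left[OF s2] sp_form_qj_left[OF s2] bilinear_rneg[OF bil2])
  qed
  have "curv_op (hlift r) X Y \<circ> L = L \<circ> curv_op (hlift r) X Y" if "L \<in> {endI, endJ, endK}" for X Y L
    using that
    by (auto intro!: com simp: inner_endJ)
      (auto simp: endI_eq endK_eq endJ_def hlift_def inner_prod_def iq riq inner_qj_left
        bilinear_rneg[OF bil2] sp_form_i_left[OF s2] sp_form_qj_left[OF s2])
  then show ?thesis
    unfolding hyperkaehler_tensor_def using alg
    by (auto simp: hlift_def sp_form_zero[OF s1] sp_form_zero[OF s2])
qed

section \<open>Quartic forms\<close>

definition antilinear :: "('n::finite E \<Rightarrow> complex) \<Rightarrow> bool" where
  "antilinear f \<longleftrightarrow> (\<forall>x y. f (x + y) = f x + f y) \<and> (\<forall>c x. f (c *s x) = cnj c * f x)"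

lemma antilinearD:
  assumes "antilinear f"
  shows "f (x + y) = f x + f y" "f (c *s x) = cnj c * f x" "f (r *\<^sub>R x) = of_real r * f x" "f (- x) = - f x"
proof -
  show 1: "f (c *s x) = cnj c * f x" for c x using assms by (simp add: antilinear_def)
  show "f (x + y) = f x + f y" using assms by (simp add: antilinear_def)
  show "f (r *\<^sub>R x) = of_real r * f x" using 1[of "of_real r" x] by (simp add: vec_complex_scaleR)
  show "f (- x) = - f x" using 1[of "- 1" x] by (simp add: vec_i_linear)
qed

lemma antilinearI:
  assumes "\<And>x y. f (x + y) = f x + f y" "\<And>r x. f (r *\<^sub>R x) = of_real r * f x"
    "\<And>x. f (\<i> *s x) = - \<i> * f x"
  shows "antilinear f"
proof -
  have "f (c *s x) = cnj c * f x" for c x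
  proof -
    have "f (c *s x) = (of_real (Re c) - \<i> * of_real (Im c)) * f x"
      unfolding vec_complex_split[of c x] assms by (simp add: algebra_simps)
    also have "of_real (Re c) - \<i> * of_real (Im c) = cnj c" by (simp add: complex_eq_iff)
    finally show ?thesis .
  qed
  with assms(1) show ?thesis by (simp add: antilinear_def)
qed

lemma antilinear_expand:
  assumes "antilinear f"
  shows "(\<Sum>p\<in>UNIV. f (axis p 1) * cnj (x $ p)) = f x"
proof -
  have "f 0 = 0" using antilinearD(2)[OF assms, of 0 0] by simp
  then have "f (\<Sum>p\<in>UNIV. x $ p *s axis p 1) = (\<Sum>p\<in>UNIV. f (x $ p *s axis p 1))"
    using sum_comp_morphism[of f "\<lambda>p. x $ p *s axis p 1" UNIV] antilinearD(1)[OF assms]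
    by (simp add: o_def)
  then show ?thesis
    by (simp add: antilinearD(2)[OF assms] basis_expansion mult.commute)
qed

type_synonym 'n form4 = "'n E \<Rightarrow> 'n E \<Rightarrow> 'n E \<Rightarrow> 'n E \<Rightarrow> complex"

definition antilinear4 :: "'n::finite form4 \<Rightarrow> bool" where
  "antilinear4 N \<longleftrightarrow> (\<forall>y z w. antilinear (\<lambda>x. N x y z w)) \<and> (\<forall>x z w. antilinear (\<lambda>y. N x y z w)) \<and>
     (\<forall>x y w. antilinear (\<lambda>z. N x y z w)) \<and> (\<forall>x y z. antilinear (\<lambda>w. N x y z w))"

lemma antilinear4D:
  assumes "antilinear4 N"
  shows "antilinear (\<lambda>x. N x y z w)" "antilinear (\<lambda>y. N x y z w)" "antilinear (\<lambda>z. N x y z w)"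
    "antilinear (\<lambda>w. N x y z w)"
  using assms by (simp_all add: antilinear4_def)

text \<open>The Hermitian pairing of s with decomposable tensors. Conjugated coordinates make the
  action of a unitary a on tensors a pullback along the inverse of a, so no dual representation is
  needed.\<close>

definition pairing :: "'n::finite E4 \<Rightarrow> 'n form4" where
  "pairing s x y z w = (\<Sum>p\<in>UNIV. \<Sum>q\<in>UNIV. \<Sum>r\<in>UNIV. \<Sum>t\<in>UNIV.
     s $ p $ q $ r $ t * cnj (w $ t) * cnj (z $ r) * cnj (y $ q) * cnj (x $ p))"

definition tensor_of :: "'n::finite form4 \<Rightarrow> 'n E4" where
  "tensor_of N = (\<chi> p q r t. N (axis p 1) (axis q 1) (axis r 1) (axis t 1))"

lemma pairing_tensor_of:
  assumes "antilinear4 N"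
  shows "pairing (tensor_of N) = N"
proof (intro ext)
  fix x y z w
  have "pairing (tensor_of N) x y z w = (\<Sum>p\<in>UNIV. (\<Sum>q\<in>UNIV. (\<Sum>r\<in>UNIV. (\<Sum>t\<in>UNIV.
     N (axis p 1) (axis q 1) (axis r 1) (axis t 1) * cnj (w $ t)) * cnj (z $ r)) * cnj (y $ q)) * cnj (x $ p))"
    by (simp add: pairing_def tensor_of_def sum_distrib_right)
  also have "\<dots> = N x y z w"
    by (simp only: antilinear4D[OF assms, THEN antilinear_expand])
  finally show "pairing (tensor_of N) x y z w = N x y z w" .
qed

lemma antilinear4_pairing: "antilinear4 (pairing s)"
  unfolding antilinear4_def antilinear_def pairing_def
  by (simp add: sum.distrib[symmetric] sum_distrib_left algebra_simps)

lemmas pairing_antilinear = antilinear4D[OF antilinear4_pairing]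
lemma pairing_axis: "pairing s (axis p 1) (axis q 1) (axis r 1) (axis t 1) = s $ p $ q $ r $ t"
proof -
  have "(\<Sum>k\<in>UNIV. f k * cnj (axis m 1 $ k)) = f m" for f :: "'a + 'a \<Rightarrow> complex" and m
    by (simp add: axis_def if_distrib cong: if_cong)
  then show ?thesis
    by (simp add: pairing_def sum_distrib_right[symmetric])
qed

lemma pairing_inj: "pairing s = pairing s' \<Longrightarrow> s = s'"
  by (simp add: vec_eq_iff pairing_axis[symmetric])

lemma pairing_linear:
  "pairing (s + s') x y z w = pairing s x y z w + pairing s' x y z w"
  "pairing (s - s') x y z w = pairing s x y z w - pairing s' x y z w"
  "pairing (c *\<^sub>R s) x y z w = of_real c * pairing s x y z w"
  "pairing (i_times_E4 s) x y z w = \<i> * pairing s x y z w"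
  "pairing 0 x y z w = 0"
  by (simp_all add: pairing_def i_times_E4_def sum.distrib sum_subtractf sum_distrib_left algebra_simps
      scaleR_conv_of_real[of _ "_ :: complex"])

definition sym4 :: "'n::finite form4 \<Rightarrow> bool" where
  "sym4 N \<longleftrightarrow> (\<forall>x y z w. N y x z w = N x y z w \<and> N x z y w = N x y z w \<and> N x y w z = N x y z w)"

lemma sym4D: "sym4 N \<Longrightarrow> N y x z w = N x y z w" "sym4 N \<Longrightarrow> N x z y w = N x y z w"
  "sym4 N \<Longrightarrow> N x y w z = N x y z w"
  unfolding sym4_def by blast+

lemma antilinear4_transpose:
  assumes "antilinear4 N"
  shows "antilinear4 (\<lambda>x y z w. N y x z w)" "antilinear4 (\<lambda>x y z w. N x z y w)" "antilinear4 (\<lambda>x y z w. N x y w z)"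
  using assms unfolding antilinear4_def by blast+

lemma S4E_iff: "s \<in> S4E \<longleftrightarrow> sym4 (pairing s)"
proof
  assume s: "s \<in> S4E"
  have "s = tensor_of (\<lambda>x y z w. pairing s y x z w)" "s = tensor_of (\<lambda>x y z w. pairing s x z y w)"
    "s = tensor_of (\<lambda>x y z w. pairing s x y w z)"
    unfolding tensor_of_def pairing_axis vec_eq_iff vec_lambda_beta using s unfolding S4E_def by blast+
  then have "pairing s = (\<lambda>x y z w. pairing s y x z w)" "pairing s = (\<lambda>x y z w. pairing s x z y w)"
    "pairing s = (\<lambda>x y z w. pairing s x y w z)"
    by (metis pairing_tensor_of antilinear4_transpose antilinear4_pairing)+
  then show "sym4 (pairing s)"
    unfolding sym4_def by metis
next
  assume "sym4 (pairing s)"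
  then show "s \<in> S4E"
    unfolding S4E_def pairing_axis[symmetric] by (auto simp: sym4D)
qed

text \<open>The inverse of a is its conjugate transpose b, and conjugating the coordinates of b e_i
  returns row i of a, as in \<open>act_E4\<close>.\<close>

lemma pairing_act:
  assumes "a \<in> unitary_matrices"
  shows "pairing (act_E4 a s) (a *v x) (a *v y) (a *v z) (a *v w) = pairing s x y z w"
proof -
  define b where "b = transpose (map_matrix cnj a)"
  have ab: "a ** b = mat 1" using assms by (simp add: unitary_matrices_def b_def)
  then have "b ** a = mat 1" by (simp add: matrix_left_right_inverse)
  then have ba: "b *v (a *v x) = x" for x by (simp add: matrix_vector_mul_assoc)
  define N where "N x y z w = pairing s (b *v x) (b *v y) (b *v z) (b *v w)" for x y z w
  have "antilinear4 N"
    using antilinear4_pairing[of s] unfolding antilinear4_def antilinear_def N_def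
    by (simp add: matrix_vector_right_distrib vector_scalar_commute)
  moreover have "tensor_of N = act_E4 a s"
  proof -
    have "cnj ((b *v axis i 1) $ p) = a $ i $ p" for i p
      by (simp add: matrix_vector_mult_def b_def transpose_def map_matrix_def axis_def if_distrib cong: if_cong)
    then show ?thesis
      by (simp add: tensor_of_def act_E4_def N_def pairing_def vec_eq_iff mult_ac)
  qed
  ultimately have "pairing (act_E4 a s) = N" using pairing_tensor_of by metis
  then show ?thesis by (simp add: N_def ba)
qed

section \<open>The real form of S^4E\<close>

definition real_S4E :: "'n::finite E4 set" where
  "real_S4E = {s \<in> S4E. \<forall>x y z w. pairing s (qj x) (qj y) (qj z) (qj w) = cnj (pairing s x y z w)}"

text \<open>Pulling back by \<open>qj\<close> and conjugating is a real structure with fixed points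
  \<open>real_S4E\<close>: it is an involution because \<open>qj\<close> squares to -1 and the
  degree 4 is even, and it is Sp(n)-equivariant because a commutes with \<open>qj\<close>.\<close>

lemma real_form_real_S4E: "real_form_S4E (real_S4E :: 'n::finite E4 set)"
  unfolding real_form_S4E_def
proof (intro conjI ballI)
  show "subspace (real_S4E :: 'n E4 set)"
    unfolding subspace_def real_S4E_def S4E_iff sym4_def by (auto simp: pairing_linear)
  show "real_S4E \<subseteq> (S4E :: 'n E4 set)" by (auto simp: real_S4E_def)
  show "act_E4 a ` real_S4E \<subseteq> real_S4E" if a: "a \<in> Sp" for a :: "complex ^ ('n + 'n) ^ ('n + 'n)"
  proof
    fix s' assume "s' \<in> act_E4 a ` real_S4E"
    then obtain s where s: "sym4 (pairing s)"
      "\<And>x y z w. pairing s (qj x) (qj y) (qj z) (qj w) = cnj (pairing s x y z w)" and s': "s' = act_E4 a s"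
      by (auto simp: real_S4E_def S4E_iff)
    have U: "a \<in> unitary_matrices" and q: "qj (a *v x) = a *v qj x" for x
      using a by (simp_all add: Sp_iff)
    have surj: "\<exists>x. y = a *v x" for y using unitary_inner(2)[OF U] by (metis surjD)
    have "sym4 (pairing s')"
      unfolding sym4_def
    proof (intro allI)
      fix x y z w
      obtain x' y' z' w' where "x = a *v x'" "y = a *v y'" "z = a *v z'" "w = a *v w'"
        using surj by metis
      then show "pairing s' y x z w = pairing s' x y z w \<and> pairing s' x z y w = pairing s' x y z w
          \<and> pairing s' x y w z = pairing s' x y z w"
        by (simp add: s' pairing_act[OF U] sym4D[OF s(1)])
    qed
    moreover have "pairing s' (qj x) (qj y) (qj z) (qj w) = cnj (pairing s' x y z w)" for x y z w
    proof -
      obtain x' y' z' w' where "x = a *v x'" "y = a *v y'" "z = a *v z'" "w = a *v w'"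
        using surj by metis
      then show ?thesis by (simp add: s' pairing_act[OF U] q s(2))
    qed
    ultimately show "s' \<in> real_S4E" by (simp add: real_S4E_def S4E_iff)
  qed
  show "bij_betw (\<lambda>(u, v). u + i_times_E4 v) (real_S4E \<times> real_S4E) (S4E :: 'n E4 set)"
    unfolding bij_betw_def
  proof
    show "inj_on (\<lambda>(u, v). u + i_times_E4 v) (real_S4E \<times> real_S4E :: ('n E4 \<times> 'n E4) set)"
    proof (rule inj_onI, clarify)
      fix u v u' v' :: "'n E4"
      assume m: "u \<in> real_S4E" "v \<in> real_S4E" "u' \<in> real_S4E" "v' \<in> real_S4E"
        and eq: "u + i_times_E4 v = u' + i_times_E4 v'"
      have e: "pairing u x y z w + \<i> * pairing v x y z w = pairing u' x y z w + \<i> * pairing v' x y z w" for x y z w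
        using arg_cong[OF eq, of "\<lambda>s. pairing s x y z w"] by (simp add: pairing_linear)
      \<comment> \<open>Applying \<open>qj\<close> to all arguments conjugates the values of the
        real tensors but not the factor i, which separates the two parts.\<close>
      have "pairing u x y z w = pairing u' x y z w \<and> pairing v x y z w = pairing v' x y z w" for x y z w
        using e[of x y z w] e[of "qj x" "qj y" "qj z" "qj w"] m
        by (simp add: real_S4E_def complex_eq_iff)
      then show "u = u' \<and> v = v'" by (intro conjI pairing_inj ext) auto
    qed
    show "(\<lambda>(u, v). u + i_times_E4 v) ` (real_S4E \<times> real_S4E) = (S4E :: 'n E4 set)"
    proof
      show "(\<lambda>(u, v). u + i_times_E4 v) ` (real_S4E \<times> real_S4E) \<subseteq> (S4E :: 'n E4 set)"
        by (auto simp: real_S4E_def S4E_iff sym4_def pairing_linear)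
      show "(S4E :: 'n E4 set) \<subseteq> (\<lambda>(u, v). u + i_times_E4 v) ` (real_S4E \<times> real_S4E)"
      proof
        fix s :: "'n E4" assume "s \<in> S4E"
        then have sym: "sym4 (pairing s)" by (simp add: S4E_iff)
        define c where "c = tensor_of (\<lambda>x y z w. cnj (pairing s (qj x) (qj y) (qj z) (qj w)))"
        have "antilinear4 (\<lambda>x y z w. cnj (pairing s (qj x) (qj y) (qj z) (qj w)))"
          using antilinear4_pairing[of s] unfolding antilinear4_def antilinear_def by simp
        then have c: "pairing c x y z w = cnj (pairing s (qj x) (qj y) (qj z) (qj w))" for x y z w
          unfolding c_def by (simp add: pairing_tensor_of)
        have neg4: "pairing s (- x) (- y) (- z) (- w) = pairing s x y z w" for x y z w
          by (simp only: pairing_antilinear[THEN antilinearD(4)] minus_minus)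
        \<comment> \<open>With c the image of s under the real structure, u = (s + c)/2 and v = (s -
          c)/(2i) = i (c - s)/2.\<close>
        define u where "u = (1/2) *\<^sub>R (s + c)"
        define v where "v = (1/2) *\<^sub>R i_times_E4 (c - s)"
        have "u \<in> real_S4E" "v \<in> real_S4E"
          by (simp_all add: u_def v_def real_S4E_def S4E_iff sym4_def pairing_linear c neg4 sym4D[OF sym] algebra_simps)
        moreover have "s = u + i_times_E4 v"
          by (intro pairing_inj ext) (simp add: u_def v_def pairing_linear algebra_simps)
        ultimately show "s \<in> (\<lambda>(u, v). u + i_times_E4 v) ` (real_S4E \<times> real_S4E)" by force
      qed
    qed
  qed
qed


section \<open>Hyper-Kaehler tensors and real quartic forms\<close>

definition hkform :: "'n::finite E4 \<Rightarrow> 'n hor4" where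
  "hkform s x y z w = Re (pairing s (qj x) y (qj z) w - pairing s (qj y) x (qj z) w) / 2"

text \<open>The extension of r to a form that is complex linear in x and z and antilinear in y and w.\<close>

definition sesq :: "'n::finite hor4 \<Rightarrow> 'n form4" where
  "sesq r x y z w = Complex (r x y z w - r x (\<i> *s y) z (\<i> *s w)) (r x (\<i> *s y) z w + r x y z (\<i> *s w))"

lemmas pairing_simps = pairing_antilinear[THEN antilinearD(1)] pairing_antilinear[THEN antilinearD(2)]
  pairing_antilinear[THEN antilinearD(3)] pairing_antilinear[THEN antilinearD(4)]

text \<open>In the first term of \<open>hkform\<close> y is an antilinear argument, in the second a
  linear one, so the combinations in \<open>sesq\<close> double the first and cancel the second.
  This accounts for the 1/2 in \<open>hkform\<close> and lets s be recovered.\<close>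

lemma sesq_hkform: "sesq (hkform s) x y z w = pairing s (qj x) y (qj z) w"
  by (simp add: sesq_def hkform_def complex_eq_iff pairing_simps field_simps)

lemma hkform_inj: "hkform s = hkform s' \<Longrightarrow> s = s'"
proof -
  assume eq: "hkform s = hkform s'"
  have "pairing s x y z w = pairing s' x y z w" for x y z w
    using sesq_hkform[of s "- qj x" y "- qj z" w] sesq_hkform[of s' "- qj x" y "- qj z" w]
    by (simp add: eq)
  then show "s = s'" by (intro pairing_inj ext)
qed

lemma hkform_linear:
  "hkform (s + s') x y z w = hkform s x y z w + hkform s' x y z w"
  "hkform (c *\<^sub>R s) x y z w = c * hkform s x y z w"
  by (simp_all add: hkform_def pairing_linear algebra_simps add_divide_distrib diff_divide_distrib)

lemma hk_hkform:
  fixes s :: "'n::finite E4"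
  assumes "s \<in> real_S4E"
  shows "hk (hkform s)"
proof -
  have sym: "sym4 (pairing s)"
    and real: "\<And>x y z w. pairing s (qj x) (qj y) (qj z) (qj w) = cnj (pairing s x y z w)"
    using assms by (auto simp: real_S4E_def S4E_iff)
  note sy = sym4D[OF sym]
  have "sp_form (\<lambda>x y. hkform s x y z w)" for z w
    unfolding sp_form_def bilinear_def
  proof (intro conjI allI linearI)
    show "hkform s (qj x) (qj y) z w = hkform s x y z w" for x y
      by (simp add: hkform_def pairing_simps sy)
  qed (simp_all add: hkform_def pairing_simps algebra_simps add_divide_distrib diff_divide_distrib)
  moreover have "hkform s x y z w = hkform s z w x y" for x y z w
  proof -
    \<comment> \<open>The first term of \<open>hkform\<close> is symmetric in the two pairs by
      itself. The second needs reality: applying \<open>qj\<close> everywhere moves K to the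
      complementary two arguments.\<close>
    have "Re (pairing s (qj w) z (qj x) y) = Re (pairing s (qj y) x (qj z) w)"
      using arg_cong[OF real[of "qj w" z "qj x" y], of Re] by (simp add: pairing_simps sy)
    then show ?thesis by (simp add: hkform_def sy)
  qed
  moreover have "hkform s x y z w + hkform s y z x w + hkform s z x y w = 0" for x y z w
    by (simp add: hkform_def sy field_simps)
  ultimately show ?thesis unfolding hk_def sp_square_def by blast
qed

text \<open>Inserting \<open>qj\<close> turns a skew form of sp(n) into a symmetric one, the real
  counterpart of sp(n) tensor C = S^2 E. The variants with i serve the other terms of
  \<open>sesq\<close>.\<close>

lemma sp_form_qj_swap:
  assumes "sp_form a"
  shows "a (qj y) x = a (qj x) y" "a (qj y) (\<i> *s x) = a (qj x) (\<i> *s y)"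
    "a x (qj y) = - a (qj x) y" "a x (\<i> *s qj y) = a (qj x) (\<i> *s y)"
proof -
  show 1: "a x (qj y) = - a (qj x) y" for x y
    using sp_form_qj_left[OF assms, of x y] by simp
  have "\<i> *s qj y = - qj (\<i> *s y)" for y :: "'a E" by (simp add: vec_i_linear)
  then show 2: "a x (\<i> *s qj y) = a (qj x) (\<i> *s y)" for x y
    by (simp only: bilinear_rneg[OF sp_form_bilinear[OF assms]] 1 minus_minus)
  show "a (qj y) x = a (qj x) y"
    using 1[of x y] sp_form_skew[OF assms, of x "qj y"] by simp
  show "a (qj y) (\<i> *s x) = a (qj x) (\<i> *s y)"
    using 2[of x y] sp_form_skew[OF assms, of "\<i> *s x" "qj y"] sp_form_i_left[OF assms, of x "qj y"] by simp
qed

lemma hkform_surj: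
  fixes r :: "'n::finite hor4"
  assumes r: "hk r"
  obtains s where "s \<in> real_S4E" "hkform s = r"
proof -
  note s = hk_sp_square[OF r]
  note s1 = sp_square_sp_form_left[OF s] and s2 = sp_square_sp_form_right[OF s]
  note bil1 = sp_form_bilinear[OF s1] and bil2 = sp_form_bilinear[OF s2]
  note bil = bilinear_ladd[OF bil1] bilinear_radd[OF bil1] bilinear_ladd[OF bil2] bilinear_radd[OF bil2]
    bilinear_lmul[OF bil1] bilinear_rmul[OF bil1] bilinear_lmul[OF bil2] bilinear_rmul[OF bil2]
    bilinear_lneg[OF bil1] bilinear_rneg[OF bil1] bilinear_lneg[OF bil2] bilinear_rneg[OF bil2]
  define N where "N x y z w = sesq r (qj x) y (qj z) w" for x y z w
  have N: "antilinear4 N"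
    unfolding antilinear4_def
    by (intro conjI allI antilinearI)
      (simp_all add: N_def sesq_def complex_eq_iff vec_i_linear bil sp_form_i_left[OF s1] sp_form_i_left[OF s2]
        algebra_simps)
  have s12: "N y x z w = N x y z w" for x y z w
    by (simp add: N_def sesq_def sp_form_qj_swap(1,2)[OF s1, of y x])
  have s34: "N x y w z = N x y z w" for x y z w
  proof -
    have "r u v (qj w) z = r u v (qj z) w" "r u v (qj w) (\<i> *s z) = r u v (qj z) (\<i> *s w)" for u v
      by (rule sp_form_qj_swap[OF s2])+
    then show ?thesis by (simp add: N_def sesq_def)
  qed
  have s13: "N z y x w = N x y z w" for x y z w
  proof -
    \<comment> \<open>The error of exchanging x and z is -r(z, x, y, w), where y and w form one
      pair. It is i-invariant in this pair, so both combinations in \<open>sesq\<close> annihilate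
      it.\<close>
    have b: "r x y z w - r z y x w = - r z x y w" for x y z w
      using hk_bianchi[OF r, of x y z w] sp_form_skew[OF s1, of y z x w] by simp
    have "sesq r x y z w = sesq r z y x w" for x y z w
      using b[of x y z w] b[of x "\<i> *s y" z "\<i> *s w"] b[of x "\<i> *s y" z w] b[of x y z "\<i> *s w"]
        sp_form_i[OF s2, of z x y w] sp_form_i_left[OF s2, of z x y w]
      unfolding sesq_def by simp
    then show ?thesis by (simp add: N_def)
  qed
  have s23: "N x z y w = N x y z w" for x y z w
    by (metis s12 s13)
  have sym: "sym4 N" unfolding sym4_def using s12 s23 s34 by blast
  have real: "N (qj x) (qj y) (qj z) (qj w) = cnj (N x y z w)" for x y z w
    by (simp add: N_def sesq_def complex_eq_iff bil sp_form_qj_swap(3,4)[OF s1] sp_form_qj_swap(3,4)[OF s2])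
  have pN: "pairing (tensor_of N) = N" by (rule pairing_tensor_of[OF N])
  show thesis
  proof
    show "tensor_of N \<in> real_S4E"
      by (simp add: real_S4E_def S4E_iff pN sym real)
    \<comment> \<open>This cancels the i-terms of the two \<open>sesq\<close> values, leaving (r x y
      z w - r y x z w)/2.\<close>
    have "r x (\<i> *s y) z (\<i> *s w) = r y (\<i> *s x) z (\<i> *s w)" for x y z w
      using sp_form_skew[OF s1, of y "\<i> *s x" z "\<i> *s w"] sp_form_i_left[OF s1, of x y z "\<i> *s w"]
      by simp
    then have "hkform (tensor_of N) x y z w = r x y z w" for x y z w
      using sp_form_skew[OF s1, of y x z w] by (simp add: hkform_def pN N_def sesq_def bil)
    then show "hkform (tensor_of N) = r" by (intro ext)
  qed
qed


section \<open>Equivariance and the isomorphism\<close>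

lemma omega_scale: "omega (c *s x) (d *s y) = c * d * omega x y"
  using inner_scale_scale[of c "qj x" "cnj d" y] inner_scale_scale[of "- \<i> * c" "qj x" "cnj d" y]
  by (simp add: omega_def complex_eq_iff inner_complex_def algebra_simps)

lemma rho_simps:
  assumes "a \<in> Sp" "b \<in> U1"
  shows "qj (b *s (a *v x)) = cnj b *s (a *v qj x)" "(a *v x) \<bullet> (a *v y) = x \<bullet> y"
    "omega (a *v x) (a *v y) = omega x y" "\<i> *s (a *v x) = a *v (\<i> *s x)" "cnj b * b = 1" "cmod b = 1"
    "rho a b \<in> rho_group"
proof -
  have q: "qj (a *v x) = a *v qj x" for x
    using assms by (simp add: Sp_iff)
  show U: "(a *v x) \<bullet> (a *v y) = x \<bullet> y" for x y
    using assms by (intro unitary_inner(1)) (simp add: Sp_iff)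
  show i: "\<i> *s (a *v x) = a *v (\<i> *s x)" for x
    by (simp add: vector_scalar_commute)
  show "omega (a *v x) (a *v y) = omega x y"
    by (simp add: omega_def q U i)
  show "qj (b *s (a *v x)) = cnj b *s (a *v qj x)" by (simp add: q)
  show "cmod b = 1" using assms by (simp add: U1_def)
  then show "cnj b * b = 1" using complex_norm_square[of b] by (simp add: mult.commute)
  show "rho a b \<in> rho_group" using assms by (auto simp: rho_group_def)
qed

text \<open>U(1) rotates I and K into each other, so their terms are invariant only together.
  Combined into \<open>omega\<close>, they are multiplied by the phase b^2, which the inner product
  does not see.\<close>

lemma sp_proj_omega:
  "sp_proj u v x y = ((x \<bullet> u) * (y \<bullet> v) - (x \<bullet> v) * (y \<bullet> u))
     + (((\<i> *s x) \<bullet> u) * ((\<i> *s y) \<bullet> v) - ((\<i> *s x) \<bullet> v) * ((\<i> *s y) \<bullet> u))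
     + (omega x u \<bullet> omega y v - omega x v \<bullet> omega y u)"
  by (simp add: sp_proj_def omega_def inner_complex_def)

lemma R0_rho:
  assumes "a \<in> Sp" "b \<in> U1"
  shows "R0 (rho a b X) (rho a b Y) (rho a b Z) (rho a b W) = R0 X Y Z W"
proof -
  note cm = rho_simps(6)[OF assms]
  have 1: "(b *s (a *v x)) \<bullet> (b *s (a *v y)) = x \<bullet> y" for x y
    by (simp add: inner_vec_mult rho_simps(2)[OF assms] cm)
  have 2: "(\<i> *s (b *s (a *v x))) \<bullet> (b *s (a *v y)) = (\<i> *s x) \<bullet> y" for x y
  proof -
    have "\<i> *s (b *s (a *v x)) = b *s (a *v (\<i> *s x))"
      by (simp add: vector_scalar_commute mult.commute)
    then show ?thesis by (simp only: 1)
  qed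
  have 3: "omega (b *s (a *v x)) (b *s (a *v u)) \<bullet> omega (b *s (a *v y)) (b *s (a *v v)) = omega x u \<bullet> omega y v"
    for x y u v
    unfolding omega_scale inner_complex_mult by (simp add: rho_simps(3)[OF assms] cm norm_mult)
  have "(\<i> * (b\<^sup>2 * v)) \<bullet> (b\<^sup>2 * w) = (\<i> * v) \<bullet> w" for v w
    using inner_complex_mult[of "b\<^sup>2" "\<i> * v" w] cm by (simp add: norm_power mult_ac)
  then have b: "beta (rho a b X) (rho a b Y) = beta X Y" for X Y
    by (simp only: beta_eq rho_def fst_conv snd_conv 2)
  show ?thesis
    unfolding R0_eq b unfolding rho_def fst_conv sp_proj_omega 1 2 3 ..
qed

text \<open>The arguments containing \<open>qj\<close> receive \<open>cnj b\<close>, the other two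
  receive b. The form is antilinear in all four, so the scalars cancel.\<close>

lemma hkform_act:
  assumes "a \<in> Sp" "b \<in> U1"
  shows "hkform (act_E4 a s) (b *s (a *v x)) (b *s (a *v y)) (b *s (a *v z)) (b *s (a *v w)) = hkform s x y z w"
proof -
  have U: "a \<in> unitary_matrices" using assms by (simp add: Sp_iff)
  have "pairing (act_E4 a s) (cnj b *s (a *v x)) (b *s (a *v y)) (cnj b *s (a *v z)) (b *s (a *v w))
      = (cnj b * b) * (cnj b * b) * pairing s x y z w" for x y z w
    by (simp add: pairing_simps pairing_act[OF U] mult_ac)
  then show ?thesis
    unfolding hkform_def rho_simps(1)[OF assms] rho_simps(5)[OF assms] by simp
qed

lemma act_tensor4_curv_of:
  assumes "a \<in> Sp" "b \<in> U1"
  shows "act_tensor4 (rho a b) (curv_of c (hkform s)) = curv_of c (hkform (act_E4 a s))"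
proof -
  note h = rho_groupD[OF rho_simps(7)[OF assms]]
  have "X = 0" if "rho a b X = 0" for X
    using h(2)[of X X] that by simp
  then have inj: "inj (rho a b)" using linear_injective_0[OF h(1)] by blast
  then have surj: "surj (rho a b)" using linear_injective_imp_surjective[OF h(1)] by simp
  \<comment> \<open>Evaluating at images under \<open>rho a b\<close>, which is surjective, avoids a
    formula for its inverse.\<close>
  have "act_tensor4 (rho a b) (curv_of c (hkform s)) (rho a b X) (rho a b Y) (rho a b Z) (rho a b W)
      = curv_of c (hkform (act_E4 a s)) (rho a b X) (rho a b Y) (rho a b Z) (rho a b W)" for X Y Z W
    by (simp add: act_tensor4_def inv_f_f[OF inj] curv_of_def R0_rho[OF assms])
      (simp add: hlift_def rho_def hkform_act[OF assms])
  note on_image = this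
  show ?thesis
  proof (intro ext)
    fix X Y Z W
    obtain X' Y' Z' W' where "X = rho a b X'" "Y = rho a b Y'" "Z = rho a b Z'" "W = rho a b W'"
      using surj by (meson surjD)
    then show "act_tensor4 (rho a b) (curv_of c (hkform s)) X Y Z W = curv_of c (hkform (act_E4 a s)) X Y Z W"
      by (simp only: on_image)
  qed
qed

lemma curv_space_iso_curv_of:
  "curv_space_iso (real_S4E :: 'n::finite E4 set) (\<lambda>(c, s). curv_of c (hkform s))"
  unfolding curv_space_iso_def
proof (intro conjI ballI allI)
  show "bij_betw (\<lambda>(c, s). curv_of c (hkform s)) (UNIV \<times> real_S4E) (curv_space :: 'n tensor4 set)"
    unfolding bij_betw_def
  proof
    show "inj_on (\<lambda>(c, s). curv_of c (hkform s)) (UNIV \<times> real_S4E :: (real \<times> 'n E4) set)"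
      by (rule inj_onI) (auto dest: curv_of_inj[OF hk_hkform hk_hkform] intro: hkform_inj)
    show "(\<lambda>(c, s). curv_of c (hkform s)) ` (UNIV \<times> real_S4E) = (curv_space :: 'n tensor4 set)"
      unfolding curv_space_eq
    proof (intro equalityI subsetI)
      fix R :: "'n tensor4" assume "R \<in> {curv_of c r | c r. hk r}"
      then obtain c r where "hk r" "R = curv_of c r" by blast
      then show "R \<in> (\<lambda>(c, s). curv_of c (hkform s)) ` (UNIV \<times> real_S4E)"
        using hkform_surj[of r] by (metis (mono_tags, lifting) SigmaI UNIV_I case_prod_conv image_eqI)
    qed (use hk_hkform in auto)
  qed
  show "(\<lambda>(c, s). curv_of c (hkform s)) (x, act_E4 a v) =
      act_tensor4 (rho a b) ((\<lambda>(c, s). curv_of c (hkform s)) (x, v))"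
    if "a \<in> Sp" "b \<in> U1" "v \<in> real_S4E" for a b x and v :: "'n E4"
    using that by (simp add: act_tensor4_curv_of)
qed (auto simp: curv_of_def hlift_def hkform_linear fun_eq_iff algebra_simps)

theorem corollary4p2:
  "\<exists>(V :: 'n::finite E4 set) (F :: real \<times> 'n E4 \<Rightarrow> 'n tensor4).
     real_form_S4E V \<and> curv_space_iso V F \<and>
     (\<forall>R \<in> (curv_space :: 'n tensor4 set). \<forall>z::complex.
        bianchi R = sigma_form (torsion z) \<longrightarrow>
        (let n = real CARD('n); t = norm3_sq (torsion z :: 'n tensor3) in
          (\<exists>Rhyper :: 'n tensor4.
             R = (\<lambda>X Y Z W. t / (48 * n) * R0 X Y Z W + Rhyper X Y Z W) \<and>
             hyperkaehler_tensor Rhyper \<and>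
             (\<exists>x. (\<lambda>X Y Z W. t / (48 * n) * R0 X Y Z W) = F (x, 0)) \<and>
             (\<exists>v\<in>V. Rhyper = F (0, v))) \<and>
          (\<forall>Y Z. Ric R Y Z = t / (12 * n) * ((n + 1) * g_hor Y Z + 2 * g_ver Y Z)) \<and>
          scal R = (n\<^sup>2 + n + 1) * t / (3 * n)))"
proof (intro exI conjI ballI allI impI)
  let ?F = "\<lambda>(c, s :: 'n E4). curv_of c (hkform s)"
  show "real_form_S4E (real_S4E :: 'n E4 set)" by (rule real_form_real_S4E)
  show "curv_space_iso (real_S4E :: 'n E4 set) ?F" by (rule curv_space_iso_curv_of)
  fix R :: "'n tensor4" and z :: complex
  assume "R \<in> curv_space" and b: "bianchi R = sigma_form (torsion z)"
  then obtain c r where r: "hk r" and R: "R = curv_of c r"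
    unfolding curv_space_eq by blast
  obtain s where s: "s \<in> real_S4E" "hkform s = r" by (rule hkform_surj[OF r])
  obtain x :: "'n E" where x: "x \<bullet> x \<noteq> 0" by (rule ex_nonzero_vec)
  let ?\<sigma> = "sigma_form (torsion 1) (x, 0) (\<i> *s x, 0) (0, 1) (0, \<i>)"
  \<comment> \<open>A nonzero value of sigma allows the comparison of b R = 4 c sigma with b R =
    |z|^2 sigma.\<close>
  have "?\<sigma> \<noteq> 0"
    using bianchi_R0_mixed[of x] x unfolding bianchi_R0 by auto
  moreover have "4 * c * ?\<sigma> = (cmod z)\<^sup>2 * ?\<sigma>"
    unfolding bianchi_curv_of[OF r, symmetric] sigma_form_torsion[of z, symmetric] R[symmetric] b ..
  ultimately have c: "c = (cmod z)\<^sup>2 / 4" by simp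
  define n where "n = real CARD('n)"
  define t where "t = norm3_sq (torsion z :: 'n tensor3)"
  have n: "n > 0" by (simp add: n_def)
  \<comment> \<open>12 n |z|^2 with |z|^2 = 4 c.\<close>
  have t: "t = 48 * n * c" by (simp add: t_def n_def c norm3_sq_torsion)
  have tc: "t / (48 * n) = c" "t / (12 * n) = 4 * c" "(n\<^sup>2 + n + 1) * t / (3 * n) = 16 * c * (n\<^sup>2 + n + 1)"
    using n by (simp_all add: t)
  have z: "hkform (0 :: 'n E4) = (\<lambda>x y z w. 0)"
    by (simp add: hkform_def pairing_linear fun_eq_iff)
  show "let n = real CARD('n); t = norm3_sq (torsion z :: 'n tensor3) in
          (\<exists>Rhyper :: 'n tensor4.
             R = (\<lambda>X Y Z W. t / (48 * n) * R0 X Y Z W + Rhyper X Y Z W) \<and>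
             hyperkaehler_tensor Rhyper \<and>
             (\<exists>x. (\<lambda>X Y Z W. t / (48 * n) * R0 X Y Z W) = ?F (x, 0)) \<and>
             (\<exists>v\<in>real_S4E. Rhyper = ?F (0, v))) \<and>
          (\<forall>Y Z. Ric R Y Z = t / (12 * n) * ((n + 1) * g_hor Y Z + 2 * g_ver Y Z)) \<and>
          scal R = (n\<^sup>2 + n + 1) * t / (3 * n)"
    unfolding Let_def n_def[symmetric] t_def[symmetric] tc
  proof (intro conjI allI exI[of _ "hlift r"])
    show "R = (\<lambda>X Y Z W. c * R0 X Y Z W + hlift r X Y Z W)"
      by (simp add: R curv_of_def fun_eq_iff)
    show "hyperkaehler_tensor (hlift r)" by (rule hyperkaehler_hlift[OF r])
    show "\<exists>x. (\<lambda>X Y Z W. c * R0 X Y Z W) = ?F (x, 0)"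
      by (intro exI[of _ c]) (simp add: curv_of_def hlift_def z fun_eq_iff)
    show "\<exists>v\<in>real_S4E. hlift r = ?F (0, v)"
      using s by (intro bexI[of _ s]) (simp_all add: curv_of_def hlift_def fun_eq_iff)
    show "Ric R Y Z = 4 * c * ((n + 1) * g_hor Y Z + 2 * g_ver Y Z)" for Y Z
      unfolding R n_def by (rule Ric_curv_of[OF r])
    show "scal R = 16 * c * (n\<^sup>2 + n + 1)"
      unfolding R n_def by (rule scal_curv_of[OF r])
  qed
qed

end
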